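(* Consider the half-axis Dirac operators with linear potential $L(0,x,0)$ (boundary condition $y_1(0)=0$) and $L(0,x,\frac{\pi}{2})$ (boundary condition $y_2(0)=0$). Then: (i) the eigenvalues of $L(0,x,0)$ are $\lambda_k(0,x,0)=2\sqrt{|k|}\,\operatorname{sign}(k)$, $k\in\mathbb{Z}$, and the corresponding eigenfunctions are the vector-functions $U_{2k}(x)$, $k\in\mathbb{Z}$ (restricted to the half axis); (ii) the eigenvalues of $L(0,x,\frac{\pi}{2})$ are $\lambda_k(0,x,\frac{\pi}{2})=\sqrt{2|2k+1|}\,\operatorname{sign}(2k+1)$, $k\in\mathbb{Z}$, and the corresponding eigenfunctions are the vector-functions $U_{2k+1}(x)$, $k\in\mathbb{Z}$ (restricted to the half axis).
   Context: Let $$\ell y=B\frac{dy}{dx}+\Omega_0(x)y,\qquad B=\begin{pmatrix}0&1\\ -1&0\end{pmatrix},\qquad \Omega_0(x)=\begin{pmatrix}0&x\\ x&0\end{pmatrix},\qquad y=\begin{pmatrix}y_1\\ y_2\end{pmatrix}.$$ For $\alpha\in(-\frac{\pi}{2},\frac{\pi}{2}]$, $L(0,x,\alpha)$ is the self-adjoint operator generated by $\ell$ in $L^2((0,\infty);\mathbb{C}^2)$ on the domain $D_\alpha$ of all $y$ such that $y_k\in L^2(0,\infty)$, $y_k$ is absolutely continuous on each finite segment $[0,b]$, $b>0$, $(\ell y)_k\in L^2(0,\infty)$ for $k=1,2$, and $y_1(0)\cos\alpha+y_2(0)\sin\alpha=0$. The eigenvalues are the values $\lambda\in\mathbb{C}$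 for which $\ell y=\lambda y$ has a nontrivial solution $y\in D_\alpha$; such solutions are the eigenfunctions. Here $\operatorname{sign}(0)=0$. The Chebyshev-Hermite polynomials are $H_n(x)=(-1)^n e^{x^2}\dfrac{d^n e^{-x^2}}{dx^n}$, and $\varphi_n(x)=C_n e^{-x^2/2}H_n(x)$ with $C_n=\dfrac{1}{\sqrt{2^n n!\sqrt{\pi}}}$, $n=0,1,2,\ldots$. The vector-functions $U_n$, $n\in\mathbb{Z}$, are $$U_0(x)=\begin{pmatrix}0\\ \varphi_0(x)\end{pmatrix},\qquad U_n(x)=\begin{pmatrix}\varphi_{n-1}(x)\\ \varphi_n(x)\end{pmatrix},\qquad U_{-n}(x)=\begin{pmatrix}-\varphi_{n-1}(x)\\ \varphi_n(x)\end{pmatrix},\qquad n=1,2,\ldots.$$ *)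

theory Defs
  imports "HOL-Analysis.Analysis"
begin

definition absolutely_continuous_on_interval ::
    "real \<Rightarrow> real \<Rightarrow> (real \<Rightarrow> 'a::real_normed_vector) \<Rightarrow> bool"
  where "absolutely_continuous_on_interval a b f \<longleftrightarrow>
    (\<forall>\<epsilon>>0. \<exists>\<delta>>0. \<forall>(n::nat) u v.
       (\<forall>i<n. a \<le> u i \<and> u i \<le> v i \<and> v i \<le> b) \<and>
       (\<forall>i<n. \<forall>j<n. i \<noteq> j \<longrightarrow> {u i<..<v i} \<inter> {u j<..<v j} = {}) \<and>
       (\<Sum>i<n. v i - u i) < \<delta> \<longrightarrow>
       (\<Sum>i<n. norm (f (v i) - f (u i))) < \<epsilon>)"

definition square_integrable_half_axis :: "(real \<Rightarrow> complex) \<Rightarrow> bool"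
  where "square_integrable_half_axis f \<longleftrightarrow>
    f \<in> borel_measurable (lebesgue_on {0<..}) \<and>
    integrable (lebesgue_on {0<..}) (\<lambda>x. (cmod (f x))\<^sup>2)"

definition B :: "complex^2^2"
  where "B = vector [vector [0, 1], vector [-1, 0]]"

definition Omega0 :: "real \<Rightarrow> complex^2^2"
  where "Omega0 x = vector [vector [0, of_real x], vector [of_real x, 0]]"

text \<open>
  The expression \<open>B y' + \<Omega>\<^sub>0 y\<close> is rendered as a relation: \<open>dirac_expr y x w\<close> says that
  \<open>y\<close> is differentiable at \<open>x\<close> and that the expression has the value \<open>w\<close> there. An absolutely
  continuous \<open>y\<close> is differentiable almost everywhere, so the relation then determines the value
  almost everywhere, as is usual for elements of \<open>L\<^sup>2\<close>.
\<close>

definition dirac_expr :: "(real \<Rightarrow> complex^2) \<Rightarrow> real \<Rightarrow> complex^2 \<Rightarrow> bool"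
  where "dirac_expr y x w \<longleftrightarrow>
    (\<exists>y'. (y has_vector_derivative y') (at x) \<and> w = B *v y' + Omega0 x *v y x)"

text \<open>
  Functions on the half axis are represented by functions on the real line whose values at
  negative arguments are irrelevant.
\<close>

definition dirac_domain :: "real \<Rightarrow> (real \<Rightarrow> complex^2) set"
  where "dirac_domain \<alpha> = {y.
    (\<forall>k. square_integrable_half_axis (\<lambda>x. y x $ k)) \<and>
    (\<forall>k. \<forall>b>0. absolutely_continuous_on_interval 0 b (\<lambda>x. y x $ k)) \<and>
    (\<exists>f. (AE x in lebesgue_on {0<..}. dirac_expr y x (f x)) \<and>
         (\<forall>k. square_integrable_half_axis (\<lambda>x. f x $ k))) \<and>
    y 0 $ 1 * of_real (cos \<alpha>) + y 0 $ 2 * of_real (sin \<alpha>) = 0}"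

definition dirac_eigenfunction :: "real \<Rightarrow> complex \<Rightarrow> (real \<Rightarrow> complex^2) \<Rightarrow> bool"
  where "dirac_eigenfunction \<alpha> \<mu> y \<longleftrightarrow>
    y \<in> dirac_domain \<alpha> \<and>
    (AE x in lebesgue_on {0<..}. dirac_expr y x (\<mu> *s y x)) \<and>
    (\<exists>x\<ge>0. y x \<noteq> 0)"

definition dirac_eigenvalue :: "real \<Rightarrow> complex \<Rightarrow> bool"
  where "dirac_eigenvalue \<alpha> \<mu> \<longleftrightarrow> (\<exists>y. dirac_eigenfunction \<alpha> \<mu> y)"

definition hermite :: "nat \<Rightarrow> real \<Rightarrow> real"
  where "hermite n x = (-1) ^ n * exp (x\<^sup>2) * (deriv ^^ n) (\<lambda>t. exp (- t\<^sup>2)) x"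

definition hermite_fun :: "nat \<Rightarrow> real \<Rightarrow> real"
  where "hermite_fun n x =
    1 / sqrt (2 ^ n * fact n * sqrt pi) * exp (- x\<^sup>2 / 2) * hermite n x"

definition U :: "int \<Rightarrow> real \<Rightarrow> complex^2"
  where "U n x =
    (if n = 0 then vector [0, of_real (hermite_fun 0 x)]
     else if n > 0 then
       vector [of_real (hermite_fun (nat n - 1) x), of_real (hermite_fun (nat n) x)]
     else
       vector [- of_real (hermite_fun (nat (- n) - 1) x), of_real (hermite_fun (nat (- n)) x)])"

definition eigenvalue_0 :: "int \<Rightarrow> real"
  where "eigenvalue_0 k = 2 * sqrt (of_int \<bar>k\<bar>) * of_int (sgn k)"

definition eigenvalue_pi_half :: "int \<Rightarrow> real"
  where "eigenvalue_pi_half k = sqrt (2 * of_int \<bar>2 * k + 1\<bar>) * of_int (sgn (2 * k + 1))"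

end

(* An eigenfunction is absolutely continuous and satisfies the system almost everywhere; a
   Henstock gauge argument shows that it is the integral of the right-hand side, hence a classical
   solution. Its second component f then solves the oscillator equation
   f'' = (x^2 - 1 - mu) f with mu = lambda^2 and f(0) = 0 or f'(0) = 0. The annihilation operator
   f' + x f preserves square integrability and this boundary alternative, and lowers mu by 2. If
   Re mu <= -1, then |f|^2 is convex with vanishing derivative at 0, so it is nondecreasing and a
   square integrable f vanishes. By induction on the size of Re mu, a nonzero f is a multiple of a
   Hermite function phi_n with mu = 2 n. *)
theory Submission
  imports Defs
begin

section \<open>Absolutely continuous functions\<close>

text \<open>The obstacle is that only f itself is known to be square integrable: nothing bounds f'
  or x f, so it is not clear that f' + x f is square integrable. The way out is that f' . f plus a
  multiple of the primitive of |f|^2 is a primitive of |f'|^2 + x^2 |f|^2, hence monotone; were it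
  unbounded, |f|^2 would eventually grow linearly. Lowering loses nothing while mu is nonzero, since
  mu f = x g - g' for g = f' + x f; when g vanishes, f is a Gaussian. The two boundary conditions
  are carried together: g(0) = f'(0) and g'(0) = - mu f(0), so lowering interchanges Dirichlet and
  Neumann data, and only at the end does the parity of phi_n at 0 separate even from odd indices.
  Since only Re mu enters the estimates, complex mu are treated directly and their reality is part
  of the outcome. The eigenvalue lambda = 0 stands apart, because y_1 is recovered from y_2 through
  lambda y_1 = y_2' + x y_2.\<close>

text \<open>The definition indexes the intervals by an initial segment of \<open>nat\<close>; the
  gauge argument needs them indexed by the tagged intervals of a division, so the estimate is
  transferred along a bijection.\<close>

lemma absolutely_continuous_on_interval_family:
  fixes f :: "real \<Rightarrow> 'a::real_normed_vector"
  assumes "absolutely_continuous_on_interval a b f" "\<epsilon> > 0"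
  shows "\<exists>\<delta>>0. \<forall>(I::'i set) u v. finite I \<and> (\<forall>i\<in>I. a \<le> u i \<and> u i \<le> v i \<and> v i \<le> b) \<and>
        (\<forall>i\<in>I. \<forall>j\<in>I. i \<noteq> j \<longrightarrow> {u i<..<v i} \<inter> {u j<..<v j} = {}) \<and>
        (\<Sum>i\<in>I. v i - u i) < \<delta> \<longrightarrow> (\<Sum>i\<in>I. norm (f (v i) - f (u i))) < \<epsilon>"
proof -
  obtain \<delta> where \<delta>: "\<delta> > 0" and *: "\<forall>(n::nat) u v.
       (\<forall>i<n. a \<le> u i \<and> u i \<le> v i \<and> v i \<le> b) \<and>
       (\<forall>i<n. \<forall>j<n. i \<noteq> j \<longrightarrow> {u i<..<v i} \<inter> {u j<..<v j} = {}) \<and>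
       (\<Sum>i<n. v i - u i) < \<delta> \<longrightarrow> (\<Sum>i<n. norm (f (v i) - f (u i))) < \<epsilon>"
    using assms(1)[unfolded absolutely_continuous_on_interval_def, THEN spec, THEN mp, OF assms(2)] by (elim exE conjE)
  show ?thesis
  proof (intro exI conjI allI impI, rule \<delta>, elim conjE)
    fix I :: "'i set" and u v
    assume fin: "finite I" and le: "\<forall>i\<in>I. a \<le> u i \<and> u i \<le> v i \<and> v i \<le> b"
      and dis: "\<forall>i\<in>I. \<forall>j\<in>I. i \<noteq> j \<longrightarrow> {u i<..<v i} \<inter> {u j<..<v j} = {}"
      and small: "(\<Sum>i\<in>I. v i - u i) < \<delta>"
    obtain h where h: "bij_betw h {..<card I} I"
      using ex_bij_betw_nat_finite[OF fin] by (auto simp: atLeast0LessThan)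
    have hI: "h i \<in> I" if "i < card I" for i using h that by (auto simp: bij_betw_def)
    have "(\<Sum>i<card I. norm (f (v (h i)) - f (u (h i)))) < \<epsilon>"
    proof (rule *[THEN spec, THEN spec, THEN spec, THEN mp], intro conjI)
      show "\<forall>i<card I. a \<le> u (h i) \<and> u (h i) \<le> v (h i) \<and> v (h i) \<le> b" using le hI by auto
      show "\<forall>i<card I. \<forall>j<card I. i \<noteq> j \<longrightarrow> {u (h i)<..<v (h i)} \<inter> {u (h j)<..<v (h j)} = {}"
      proof (intro allI impI)
        fix i j assume "i < card I" "j < card I" "i \<noteq> j"
        then have "h i \<noteq> h j" using h by (auto simp: bij_betw_def inj_on_def)
        then show "{u (h i)<..<v (h i)} \<inter> {u (h j)<..<v (h j)} = {}"
          using dis hI \<open>i < card I\<close> \<open>j < card I\<close> by blast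
      qed
      show "(\<Sum>i<card I. v (h i) - u (h i)) < \<delta>"
        using small sum.reindex_bij_betw[OF h, of "\<lambda>i. v i - u i"] by simp
    qed
    then show "(\<Sum>i\<in>I. norm (f (v i) - f (u i))) < \<epsilon>"
      using sum.reindex_bij_betw[OF h, of "\<lambda>i. norm (f (v i) - f (u i))"] by simp
  qed
qed

text \<open>Supplies the neighbourhood that the gauge assigns to tags in the exceptional set:
  disjoint intervals lying in \<open>T\<close> have small total length.\<close>

lemma negligible_outer_open:
  fixes N :: "real set"
  assumes "negligible N" "\<delta> > 0"
  obtains T where "open T" "N \<subseteq> T" "T \<in> lmeasurable" "measure lebesgue T < \<delta>"
proof -
  have N: "N \<in> sets lebesgue" "N \<in> lmeasurable" "measure lebesgue N = 0"
    using assms(1) by (auto simp: negligible_iff_measure fmeasurableD)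
  obtain T where T: "open T" "N \<subseteq> T" "T - N \<in> lmeasurable" "emeasure lebesgue (T - N) < ennreal \<delta>"
    using sets_lebesgue_outer_open[OF N(1) assms(2)] .
  have TN: "T = (T - N) \<union> N" using T(2) by auto
  have 1: "T \<in> lmeasurable" using TN T(3) N(2) by (metis fmeasurable.Un)
  have "measure lebesgue T \<le> measure lebesgue (T - N) + measure lebesgue N"
    using TN T(3) N(1) by (metis measure_Un_le fmeasurableD)
  moreover have "measure lebesgue (T - N) < \<delta>"
    using T(4) unfolding emeasure_eq_measure2[OF T(3)] by (simp add: ennreal_less_iff)
  ultimately show thesis using N(3) by (intro that[OF T(1,2) 1]) simp
qed

text \<open>Riemann sums are compared with telescoping increments of \<open>f\<close>. At tags
  outside \<open>N\<close> differentiability controls each error; the intervals tagged in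
  \<open>N\<close> have total length below the \<delta> of absolute continuity, which bounds their
  increments together.\<close>

theorem absolutely_continuous_has_integral_derivative:
  fixes f :: "real \<Rightarrow> 'a::banach"
  assumes ac: "absolutely_continuous_on_interval a b f" and "a \<le> b" and N: "negligible N"
    and der: "\<And>x. x \<in> {a..b} - N \<Longrightarrow> (f has_vector_derivative f' x) (at x within {a..b})"
  shows "(f' has_integral f b - f a) {a..b}"
proof -
  \<comment> \<open>The value 0 on \<open>N\<close> leaves only the increment of \<open>f\<close> at
    such tags.\<close>
  define g where "g = (\<lambda>x. if x \<in> N then 0 else f' x)"
  have "(g has_integral f b - f a) {a..b}"
    unfolding has_integral_real
  proof (intro allI impI)
    fix e :: real assume "e > 0"
    \<comment> \<open>The extra 1 keeps the denominator positive for \<open>a = b\<close> and makes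
      the total error strictly less than \<open>e / 2\<close>.\<close>
    define c where "c = e / (2 * (b - a + 1))"
    have c: "c > 0" "c * (b - a) < e / 2"
      using \<open>e > 0\<close> \<open>a \<le> b\<close> by (auto simp: c_def field_simps)
    have "\<exists>d>0. x \<in> {a..b} - N \<longrightarrow>
         (\<forall>y\<in>{a..b}. norm (y-x) < d \<longrightarrow> norm (f y - f x - (y-x) *\<^sub>R f' x) \<le> c * norm (y-x))" for x
    proof (cases "x \<in> {a..b} - N")
      case True
      then show ?thesis
        using der[OF True, unfolded has_vector_derivative_def has_derivative_within_alt] c(1) by blast
    qed (auto intro: exI[of _ 1])
    then obtain d where d: "\<And>x. 0 < d x"
      "\<And>x y. \<lbrakk>x \<in> {a..b} - N; y \<in> {a..b}; norm (y-x) < d x\<rbrakk>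
                        \<Longrightarrow> norm (f y - f x - (y-x) *\<^sub>R f' x) \<le> c * norm (y-x)"
      by metis
    obtain \<delta> where \<delta>: "\<delta> > 0" and
      ac': "\<forall>(I::(real \<times> real set) set) u v. finite I \<and> (\<forall>i\<in>I. a \<le> u i \<and> u i \<le> v i \<and> v i \<le> b) \<and>
        (\<forall>i\<in>I. \<forall>j\<in>I. i \<noteq> j \<longrightarrow> {u i<..<v i} \<inter> {u j<..<v j} = {}) \<and>
        (\<Sum>i\<in>I. v i - u i) < \<delta> \<longrightarrow> (\<Sum>i\<in>I. norm (f (v i) - f (u i))) < e / 2"
      using absolutely_continuous_on_interval_family[OF ac half_gt_zero[OF \<open>e > 0\<close>]] by (elim exE conjE)
    obtain T where T: "open T" "N \<subseteq> T" "T \<in> lmeasurable" "measure lebesgue T < \<delta>"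
      using negligible_outer_open[OF N \<delta>] .
    define \<gamma> where "\<gamma> = (\<lambda>x. if x \<in> N then T else ball x (d x))"
    have gauge: "gauge \<gamma>" using T d(1) by (auto simp: gauge_def \<gamma>_def)
    have close: "norm ((\<Sum>(x, K)\<in>p. measure lborel K *\<^sub>R g x) - (f b - f a)) < e"
      if p: "p tagged_division_of {a..b}" "\<gamma> fine p" for p
    proof -
      have fin: "finite p" using p(1) by blast
      have K: "\<exists>u v. K = {u..v} \<and> u \<le> v \<and> a \<le> u \<and> v \<le> b \<and> u \<le> x \<and> x \<le> v"
        if xK: "(x, K) \<in> p" for x K
      proof -
        have "x \<in> K" "K \<subseteq> {a..b}" using tagged_division_ofD(2,3)[OF p(1) xK] by auto
        obtain u v where K: "K = cbox u v" using tagged_division_ofD(4)[OF p(1) xK] by blast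
        with \<open>x \<in> K\<close> have "u \<le> x" "x \<le> v" by auto
        with \<open>K \<subseteq> {a..b}\<close> K show ?thesis by (intro exI[of _ u] exI[of _ v]) auto
      qed
      have fine: "snd i \<subseteq> \<gamma> (fst i)" if "i \<in> p" for i
        using p(2) that unfolding fine_def by (cases i) auto
      define q where "q = {i \<in> p. fst i \<in> N}"
      \<comment> \<open>Endpoints are written as \<open>Inf\<close> and \<open>Sup\<close>, the form
        in which \<open>additive_tagged_division_1\<close> telescopes.\<close>
      have Kq: "a \<le> Inf (snd i) \<and> Inf (snd i) \<le> Sup (snd i) \<and> Sup (snd i) \<le> b"
        and Kq': "snd i = {Inf (snd i)..Sup (snd i)}" if "i \<in> p" for i
      proof -
        have "(fst i, snd i) \<in> p" using that by simp
        from K[OF this] obtain u v where "snd i = {u..v}" "u \<le> v" "a \<le> u" "v \<le> b" by blast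
        then show "a \<le> Inf (snd i) \<and> Inf (snd i) \<le> Sup (snd i) \<and> Sup (snd i) \<le> b"
          "snd i = {Inf (snd i)..Sup (snd i)}" by simp_all
      qed
      have dis: "{Inf (snd i)<..<Sup (snd i)} \<inter> {Inf (snd j)<..<Sup (snd j)} = {}"
        if "i \<in> p" "j \<in> p" "i \<noteq> j" for i j
      proof -
        have "interior (snd i) \<inter> interior (snd j) = {}"
          using tagged_division_ofD(5)[OF p(1), of "fst i" "snd i" "fst j" "snd j"] that by auto
        moreover have "interior (snd i) = {Inf (snd i)<..<Sup (snd i)}" if "i \<in> p" for i
          by (subst Kq'[OF that]) (rule interior_atLeastAtMost_real)
        ultimately show ?thesis using that by simp
      qed
      have "(\<Sum>i\<in>q. Sup (snd i) - Inf (snd i)) < \<delta>"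
      proof -
        have "(\<Sum>i\<in>q. Sup (snd i) - Inf (snd i)) = (\<Sum>i\<in>q. measure lebesgue {Inf (snd i)<..<Sup (snd i)})"
          using Kq by (intro sum.cong) (auto simp: q_def)
        also have "\<dots> = measure lebesgue (\<Union>i\<in>q. {Inf (snd i)<..<Sup (snd i)})"
          using fin dis
          by (intro measure_UNION'[symmetric]) (auto simp: q_def pairwise_def disjnt_def)
        also have "\<dots> \<le> measure lebesgue T"
        proof (rule measure_mono_fmeasurable[OF _ _ T(3)])
          show "(\<Union>i\<in>q. {Inf (snd i)<..<Sup (snd i)}) \<subseteq> T"
          proof (rule UN_least)
            fix i assume i: "i \<in> q"
            then have "snd i \<subseteq> \<gamma> (fst i)" by (intro fine) (simp add: q_def)
            then have "snd i \<subseteq> T" using i by (auto simp: \<gamma>_def q_def)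
            moreover have "snd i = {Inf (snd i)..Sup (snd i)}" using i by (intro Kq') (simp add: q_def)
            ultimately show "{Inf (snd i)<..<Sup (snd i)} \<subseteq> T"
              using greaterThanLessThan_subseteq_atLeastAtMost_iff by blast
          qed
        qed (use fin in \<open>auto simp: q_def intro!: sets.finite_UN\<close>)
        finally show ?thesis using T(4) by simp
      qed
      then have q: "(\<Sum>i\<in>q. norm (f (Sup (snd i)) - f (Inf (snd i)))) < e / 2"
        using fin Kq dis
        by (intro ac'[THEN spec, THEN spec, THEN spec, THEN mp] conjI) (auto simp: q_def)
      have r: "(\<Sum>i\<in>p - q. norm (measure lborel (snd i) *\<^sub>R g (fst i) - (f (Sup (snd i)) - f (Inf (snd i)))))
          \<le> (\<Sum>i\<in>p - q. c * (Sup (snd i) - Inf (snd i)))"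
      proof (rule sum_mono)
        fix i assume i: "i \<in> p - q"
        obtain x u v where x: "x = fst i" "x \<notin> N" and uv: "snd i = {u..v}" "u \<le> v" "a \<le> u" "v \<le> b" "u \<le> x" "x \<le> v"
          using K[of "fst i" "snd i"] i by (auto simp: q_def)
        have "{u..v} \<subseteq> ball x (d x)"
          using fine[of i] i x uv(1) by (simp add: \<gamma>_def)
        moreover have "u \<in> {u..v}" "v \<in> {u..v}" using uv by auto
        ultimately have uvd: "norm (u - x) < d x" "norm (v - x) < d x"
          by (auto simp: subset_iff dist_norm norm_minus_commute simp del: atLeastAtMost_iff)
        \<comment> \<open>Straddle estimate: the tag lies between \<open>u\<close> and
          \<open>v\<close>, so the two one-sided errors add up to a multiple of \<open>v - u\<close>
          alone.\<close>
        have "norm ((v - u) *\<^sub>R f' x - (f v - f u)) = norm (f u - f x - (u - x) *\<^sub>R f' x - (f v - f x - (v - x) *\<^sub>R f' x))"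
          by (auto simp: algebra_simps)
        also have "\<dots> \<le> norm (f u - f x - (u - x) *\<^sub>R f' x) + norm (f v - f x - (v - x) *\<^sub>R f' x)"
          by (rule norm_triangle_ineq4)
        also have "\<dots> \<le> c * norm (u - x) + c * norm (v - x)"
          using x uv uvd by (intro add_mono d(2)) auto
        also have "\<dots> = c * (v - u)" using uv by (simp add: algebra_simps)
        finally show "norm (measure lborel (snd i) *\<^sub>R g (fst i) - (f (Sup (snd i)) - f (Inf (snd i)))) \<le> c * (Sup (snd i) - Inf (snd i))"
          using x uv by (simp add: g_def)
      qed
      have "(\<Sum>i\<in>p - q. c * (Sup (snd i) - Inf (snd i))) \<le> (\<Sum>i\<in>p. c * (Sup (snd i) - Inf (snd i)))"
        using fin Kq c(1) by (intro sum_mono2) auto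
      also have "\<dots> = c * (b - a)"
        using additive_tagged_division_1[OF \<open>a \<le> b\<close>, of p "\<lambda>x. x"] p(1)
        by (simp add: sum_distrib_left[symmetric] case_prod_beta)
      finally have r2: "(\<Sum>i\<in>p - q. norm (measure lborel (snd i) *\<^sub>R g (fst i) - (f (Sup (snd i)) - f (Inf (snd i))))) < e / 2"
        using r c(2) by simp
      have "(\<Sum>(x, K)\<in>p. measure lborel K *\<^sub>R g x) - (f b - f a)
          = (\<Sum>i\<in>p. measure lborel (snd i) *\<^sub>R g (fst i) - (f (Sup (snd i)) - f (Inf (snd i))))"
        using additive_tagged_division_1[OF \<open>a \<le> b\<close>, of p f] p(1)
        by (simp add: sum_subtractf case_prod_beta)
      also have "norm \<dots> \<le> (\<Sum>i\<in>p. norm (measure lborel (snd i) *\<^sub>R g (fst i) - (f (Sup (snd i)) - f (Inf (snd i)))))"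
        by (rule norm_sum)
      also have "\<dots> = (\<Sum>i\<in>p - q. norm (measure lborel (snd i) *\<^sub>R g (fst i) - (f (Sup (snd i)) - f (Inf (snd i)))))
          + (\<Sum>i\<in>q. norm (measure lborel (snd i) *\<^sub>R g (fst i) - (f (Sup (snd i)) - f (Inf (snd i)))))"
        using fin by (intro sum.subset_diff) (auto simp: q_def)
      also have "(\<Sum>i\<in>q. norm (measure lborel (snd i) *\<^sub>R g (fst i) - (f (Sup (snd i)) - f (Inf (snd i)))))
          = (\<Sum>i\<in>q. norm (f (Sup (snd i)) - f (Inf (snd i))))"
        by (intro sum.cong) (auto simp: q_def g_def norm_minus_commute)
      finally show ?thesis using q r2 by simp
    qed
    show "\<exists>\<gamma>. gauge \<gamma> \<and> (\<forall>\<D>. \<D> tagged_division_of {a..b} \<and> \<gamma> fine \<D> \<longrightarrow>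
        norm ((\<Sum>(x, k)\<in>\<D>. measure lborel k *\<^sub>R g x) - (f b - f a)) < e)"
      by (intro exI[of _ \<gamma>] conjI allI impI gauge, elim conjE) (rule close)
  qed
  then show ?thesis
    by (rule has_integral_spike[OF N, rotated]) (simp add: g_def)
qed

section \<open>Absolute continuity of Lipschitz and C^1 functions, and continuity\<close>

lemma lipschitz_absolutely_continuous:
  fixes f :: "real \<Rightarrow> 'a::real_normed_vector"
  assumes L: "\<And>x y. \<lbrakk>a \<le> x; x \<le> y; y \<le> b\<rbrakk> \<Longrightarrow> norm (f y - f x) \<le> C * (y - x)"
  shows "absolutely_continuous_on_interval a b f"
  unfolding absolutely_continuous_on_interval_def
proof (intro allI impI)
  fix e :: real assume "e > 0"
  \<comment> \<open>The bound \<open>C\<close> may be zero or negative; \<open>D\<close> is safe as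
    a divisor.\<close>
  define D where "D = max C 1"
  have "D > 0" by (simp add: D_def)
  show "\<exists>\<delta>>0. \<forall>(n::nat) u v.
       (\<forall>i<n. a \<le> u i \<and> u i \<le> v i \<and> v i \<le> b) \<and>
       (\<forall>i<n. \<forall>j<n. i \<noteq> j \<longrightarrow> {u i<..<v i} \<inter> {u j<..<v j} = {}) \<and>
       (\<Sum>i<n. v i - u i) < \<delta> \<longrightarrow> (\<Sum>i<n. norm (f (v i) - f (u i))) < e"
  proof (intro exI[of _ "e / D"] conjI allI impI)
    show "e / D > 0" using \<open>e > 0\<close> \<open>D > 0\<close> by simp
    fix n :: nat and u v
    assume *: "(\<forall>i<n. a \<le> u i \<and> u i \<le> v i \<and> v i \<le> b) \<and>
       (\<forall>i<n. \<forall>j<n. i \<noteq> j \<longrightarrow> {u i<..<v i} \<inter> {u j<..<v j} = {}) \<and>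
       (\<Sum>i<n. v i - u i) < e / D"
    have "(\<Sum>i<n. norm (f (v i) - f (u i))) \<le> (\<Sum>i<n. D * (v i - u i))"
    proof (rule sum_mono)
      fix i assume "i \<in> {..<n}"
      then have i: "a \<le> u i" "u i \<le> v i" "v i \<le> b" using * by auto
      have "norm (f (v i) - f (u i)) \<le> C * (v i - u i)" by (rule L[OF i])
      also have "\<dots> \<le> D * (v i - u i)" using i by (intro mult_right_mono) (auto simp: D_def)
      finally show "norm (f (v i) - f (u i)) \<le> D * (v i - u i)" .
    qed
    also have "\<dots> < e" using * \<open>D > 0\<close> by (simp add: sum_distrib_left[symmetric] pos_less_divide_eq mult.commute)
    finally show "(\<Sum>i<n. norm (f (v i) - f (u i))) < e" .
  qed
qed

lemma continuous_derivative_absolutely_continuous: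
  fixes f :: "real \<Rightarrow> 'a::real_normed_vector"
  assumes der: "\<And>x. x \<in> {a..b} \<Longrightarrow> (f has_vector_derivative f' x) (at x within {a..b})"
    and cont: "continuous_on {a..b} f'"
  shows "absolutely_continuous_on_interval a b f"
proof -
  have "bounded (f' ` {a..b})" by (intro compact_imp_bounded compact_continuous_image cont) auto
  then obtain C where C: "\<And>x. x \<in> {a..b} \<Longrightarrow> norm (f' x) \<le> C" unfolding bounded_iff by blast
  show ?thesis
  proof (rule lipschitz_absolutely_continuous[where C = C])
    fix x y assume xy: "a \<le> x" "x \<le> y" "y \<le> b"
    have "norm (f y - f x) \<le> C * norm (y - x)"
    proof (rule differentiable_bound[where S = "{a..b}" and f' = "\<lambda>x h. h *\<^sub>R f' x"])
      show "(f has_derivative (\<lambda>h. h *\<^sub>R f' z)) (at z within {a..b})" if "z \<in> {a..b}" for z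
        using der[OF that] by (simp add: has_vector_derivative_def)
      show "onorm (\<lambda>h. h *\<^sub>R f' z) \<le> C" if "z \<in> {a..b}" for z
        using C[OF that] by (intro onorm_le) (simp add: mult.commute[of C] mult_left_mono)
    qed (use xy in auto)
    then show "norm (f y - f x) \<le> C * (y - x)" using xy by simp
  qed
qed

lemma absolutely_continuous_imp_continuous_on:
  fixes f :: "real \<Rightarrow> 'a::real_normed_vector"
  assumes "absolutely_continuous_on_interval a b f"
  shows "continuous_on {a..b} f"
  unfolding continuous_on_iff
proof (intro ballI allI impI)
  fix x e :: real assume x: "x \<in> {a..b}" and "e > 0"
  obtain \<delta> where \<delta>: "\<delta> > 0" and *: "\<forall>(n::nat) u v.
       (\<forall>i<n. a \<le> u i \<and> u i \<le> v i \<and> v i \<le> b) \<and>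
       (\<forall>i<n. \<forall>j<n. i \<noteq> j \<longrightarrow> {u i<..<v i} \<inter> {u j<..<v j} = {}) \<and>
       (\<Sum>i<n. v i - u i) < \<delta> \<longrightarrow> (\<Sum>i<n. norm (f (v i) - f (u i))) < e"
    using assms[unfolded absolutely_continuous_on_interval_def, THEN spec, THEN mp, OF \<open>e > 0\<close>] by (elim exE conjE)
  have "dist (f y) (f x) < e" if "y \<in> {a..b}" "dist y x < \<delta>" for y
  proof -
    \<comment> \<open>A family consisting of one interval; \<open>min\<close> and \<open>max\<close>
      order its endpoints.\<close>
    have "norm (f (max x y) - f (min x y)) < e"
      using *[rule_format, of 1 "\<lambda>_. min x y" "\<lambda>_. max x y"] that x
      by (auto simp: dist_real_def abs_if max_def min_def split: if_splits)
    then show ?thesis by (auto simp: dist_norm max_def min_def norm_minus_commute split: if_splits)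
  qed
  with \<delta> show "\<exists>d>0. \<forall>y\<in>{a..b}. dist y x < d \<longrightarrow> dist (f y) (f x) < e" by blast
qed

section \<open>Hermite functions\<close>

text \<open>The recursion is what one differentiation of H_n(x) exp(-x^2) produces, up to the sign
  that the factor (-1)^n absorbs.\<close>

primrec hermite_poly :: "nat \<Rightarrow> real poly" where
  "hermite_poly 0 = 1"
| "hermite_poly (Suc n) = [:0, 2:] * hermite_poly n - pderiv (hermite_poly n)"

text \<open>When the recursion is differentiated, the induction hypothesis turns two of the terms
  into a multiple of the recursion one index lower, and the product rule contributes the one further
  copy that raises the factor by 2.\<close>

lemma pderiv_hermite_poly: "pderiv (hermite_poly (Suc n)) = smult (2 * real (Suc n)) (hermite_poly n)"
proof (induction n)
  case (Suc n)
  have "pderiv (hermite_poly (Suc (Suc n)))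
      = pderiv ([:0, 2:] * hermite_poly (Suc n)) - pderiv (pderiv (hermite_poly (Suc n)))"
    by (simp only: hermite_poly.simps(2)[of "Suc n"] pderiv_diff)
  also have "\<dots> = [:0, 2:] * smult (2 * real (Suc n)) (hermite_poly n) + smult 2 (hermite_poly (Suc n))
      - smult (2 * real (Suc n)) (pderiv (hermite_poly n))"
    by (simp only: Suc.IH pderiv_mult pderiv_smult) (simp add: pderiv_pCons mult.commute)
  also have "\<dots> = smult (2 * real (Suc n)) ([:0, 2:] * hermite_poly n - pderiv (hermite_poly n))
      + smult 2 (hermite_poly (Suc n))"
    by (simp only: smult_diff_right mult_smult_right add_diff_eq diff_add_eq)
  also have "\<dots> = smult (2 * real (Suc (Suc n))) (hermite_poly (Suc n))"
    by (simp only: hermite_poly.simps(2)[symmetric] smult_add_left[symmetric]) (simp add: algebra_simps)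
  finally show ?case .
qed (simp add: pderiv_pCons)

lemma higher_deriv_gaussian:
  "(deriv ^^ n) (\<lambda>t::real. exp (- t\<^sup>2)) = (\<lambda>x. (-1) ^ n * poly (hermite_poly n) x * exp (- x\<^sup>2))"
proof (induction n)
  case (Suc n)
  have "((\<lambda>x. (-1) ^ n * poly (hermite_poly n) x * exp (- x\<^sup>2)) has_real_derivative
      (-1) ^ Suc n * poly (hermite_poly (Suc n)) x * exp (- x\<^sup>2)) (at x)" for x :: real
    by (auto intro!: derivative_eq_intros simp: algebra_simps)
  then have "deriv (\<lambda>x. (-1) ^ n * poly (hermite_poly n) x * exp (- x\<^sup>2))
      = (\<lambda>x. (-1) ^ Suc n * poly (hermite_poly (Suc n)) x * exp (- x\<^sup>2))"
    by (intro ext DERIV_imp_deriv)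
  then show ?case by (simp only: funpow.simps comp_apply Suc.IH)
qed simp

lemma hermite_eq_poly: "hermite n x = poly (hermite_poly n) x"
proof -
  have "hermite n x = ((-1) ^ n * (-1) ^ n) * (exp (x\<^sup>2) * exp (- x\<^sup>2)) * poly (hermite_poly n) x"
    by (simp only: hermite_def higher_deriv_gaussian mult_ac)
  then show ?thesis by (simp add: exp_minus power_mult_distrib[symmetric])
qed

definition hermite_norm :: "nat \<Rightarrow> real" where
  "hermite_norm n = 1 / sqrt (2 ^ n * fact n * sqrt pi)"

lemma hermite_norm_nonzero [simp]: "hermite_norm n \<noteq> 0"
  by (simp add: hermite_norm_def)

text \<open>The ratio of consecutive normalisations is the origin of the factor sqrt(2(n+1)) in the
  ladder relations, and with it of the eigenvalues of the Dirac system.\<close>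

lemma hermite_norm_Suc: "hermite_norm n = sqrt (2 * real (Suc n)) * hermite_norm (Suc n)"
proof -
  have "2 ^ Suc n * fact (Suc n) * sqrt pi = (2 * real (Suc n)) * (2 ^ n * fact n * sqrt pi)"
    by (simp add: algebra_simps)
  then have "sqrt (2 ^ Suc n * fact (Suc n) * sqrt pi) = sqrt (2 * real (Suc n)) * sqrt (2 ^ n * fact n * sqrt pi)"
    by (simp only: real_sqrt_mult)
  moreover have "sqrt (2 * real (Suc n)) > 0" by simp
  ultimately show ?thesis by (simp only: hermite_norm_def) (simp del: of_nat_Suc)
qed

lemma hermite_fun_poly: "hermite_fun n x = hermite_norm n * exp (- x\<^sup>2 / 2) * poly (hermite_poly n) x"
  by (simp add: hermite_fun_def hermite_eq_poly hermite_norm_def)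

lemma hermite_fun_deriv_poly:
  "(hermite_fun n has_real_derivative
    hermite_norm n * exp (- x\<^sup>2 / 2) * (poly (pderiv (hermite_poly n)) x - x * poly (hermite_poly n) x)) (at x within S)"
  unfolding hermite_fun_poly[abs_def]
  by (auto intro!: derivative_eq_intros simp: algebra_simps)

text \<open>The creation operator x - d/dx: the polynomial recursion multiplied by the
  Gaussian.\<close>

lemma hermite_fun_raise:
  "(hermite_fun n has_real_derivative x * hermite_fun n x - sqrt (2 * real (Suc n)) * hermite_fun (Suc n) x)
    (at x within S)"
proof -
  have "sqrt (2 * real (Suc n)) * hermite_fun (Suc n) x
      = hermite_norm n * exp (- x\<^sup>2 / 2) * poly (hermite_poly (Suc n)) x"
    unfolding hermite_norm_Suc[of n] hermite_fun_poly by (simp only: mult_ac)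
  then have "hermite_norm n * exp (- x\<^sup>2 / 2) * (poly (pderiv (hermite_poly n)) x - x * poly (hermite_poly n) x)
    = x * hermite_fun n x - sqrt (2 * real (Suc n)) * hermite_fun (Suc n) x"
    by (simp only:) (simp add: hermite_fun_poly[of n] algebra_simps)
  with hermite_fun_deriv_poly[of n x S] show ?thesis by (simp only:)
qed

text \<open>The annihilation operator d/dx + x: here the derivative rule for H_{n+1} takes the place
  of the recursion.\<close>

lemma hermite_fun_lower:
  "(hermite_fun (Suc n) has_real_derivative
    sqrt (2 * real (Suc n)) * hermite_fun n x - x * hermite_fun (Suc n) x) (at x within S)"
proof -
  define r where "r = sqrt (2 * real (Suc n))"
  have r: "2 * real (Suc n) = r * r" by (simp add: r_def)
  have "hermite_norm n = r * hermite_norm (Suc n)" unfolding r_def by (rule hermite_norm_Suc)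
  then have "hermite_norm (Suc n) * exp (- x\<^sup>2 / 2) * (2 * real (Suc n) * poly (hermite_poly n) x)
      = sqrt (2 * real (Suc n)) * hermite_fun n x"
    unfolding hermite_fun_poly r_def[symmetric] unfolding r by (simp only: mult_ac)
  then have "hermite_norm (Suc n) * exp (- x\<^sup>2 / 2) *
      (poly (pderiv (hermite_poly (Suc n))) x - x * poly (hermite_poly (Suc n)) x)
    = sqrt (2 * real (Suc n)) * hermite_fun n x - x * hermite_fun (Suc n) x"
    unfolding pderiv_hermite_poly poly_smult right_diff_distrib hermite_fun_poly[of "Suc n"]
    by (simp only:) (simp only: mult_ac)
  with hermite_fun_deriv_poly[of "Suc n" x S] show ?thesis by (simp only:)
qed

lemma hermite_fun_0: "hermite_fun 0 x = hermite_norm 0 * exp (- x\<^sup>2 / 2)"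
  by (simp add: hermite_fun_poly)

lemma hermite_fun_0_deriv: "(hermite_fun 0 has_real_derivative - x * hermite_fun 0 x) (at x within S)"
  using hermite_fun_deriv_poly[of 0 x S] by (simp add: hermite_fun_0 mult_ac)

lemma hermite_fun_at_0: "hermite_fun n 0 = 0 \<longleftrightarrow> odd n"
proof (induction n rule: nat_less_induct)
  case (1 n)
  consider "n = 0" | "n = 1" | m where "n = Suc (Suc m)" by (metis One_nat_def not0_implies_Suc)
  then show ?case
  proof cases
    case 3
    \<comment> \<open>Lowering and raising both compute the derivative of phi_{m+1} at 0; equating
      them ties the value of phi_{m+2} at 0 to that of phi_m.\<close>
    have "sqrt (2 * real (Suc m)) * hermite_fun m 0 - 0 * hermite_fun (Suc m) 0
        = 0 * hermite_fun (Suc m) 0 - sqrt (2 * real (Suc (Suc m))) * hermite_fun (Suc (Suc m)) 0"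
      by (rule DERIV_unique[OF hermite_fun_lower hermite_fun_raise])
    then have "hermite_fun (Suc (Suc m)) 0 = 0 \<longleftrightarrow> hermite_fun m 0 = 0" by auto
    with 1 3 show ?thesis by simp
  qed (simp_all add: hermite_fun_poly)
qed

section \<open>Decay and square integrability of Hermite functions\<close>

lemma poly_le_exp: "\<exists>C k. \<forall>x\<ge>0. \<bar>poly p x\<bar> \<le> C * exp (real k * x)" for p :: "real poly"
proof (induction p)
  case (pCons a p)
  then obtain C k where Ck: "\<And>x. x \<ge> 0 \<Longrightarrow> \<bar>poly p x\<bar> \<le> C * exp (real k * x)" by blast
  have "\<bar>poly (pCons a p) x\<bar> \<le> (\<bar>a\<bar> + C) * exp (real (Suc k) * x)" if "x \<ge> 0" for x
  proof -
    have "\<bar>x * poly p x\<bar> \<le> exp x * (C * exp (real k * x))"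
      unfolding abs_mult using that Ck[OF that] order_trans[OF _ exp_ge_add_one_self[of x], of x] by (intro mult_mono) auto
    also have "\<dots> = C * exp (real (Suc k) * x)" by (simp add: exp_add[symmetric] algebra_simps)
    finally have "\<bar>x * poly p x\<bar> \<le> C * exp (real (Suc k) * x)" .
    moreover have "\<bar>a\<bar> * 1 \<le> \<bar>a\<bar> * exp (real (Suc k) * x)"
      using that by (intro mult_left_mono) auto
    moreover have "\<bar>poly (pCons a p) x\<bar> \<le> \<bar>a\<bar> + \<bar>x * poly p x\<bar>" by simp
    ultimately show ?thesis by (simp only: distrib_right)
  qed
  then show ?case by blast
qed (auto intro: exI[of _ 0])

lemma hermite_fun_square_le: "\<exists>C. \<forall>x\<ge>0. (hermite_fun n x)\<^sup>2 \<le> C * exp (- x)"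
proof -
  obtain C k where Ck: "\<And>x. x \<ge> 0 \<Longrightarrow> \<bar>poly (hermite_poly n) x\<bar> \<le> C * exp (real k * x)"
    using poly_le_exp[of "hermite_poly n"] by blast
  \<comment> \<open>The half-integer makes \<open>2 * q * x\<close> equal to
    \<open>2 * real k * x + x\<close>, so completing the square absorbs the exponential growth and
    still leaves a factor \<open>exp (- x)\<close>.\<close>
  define q where "q = (2 * real k + 1) / 2"
  have "(hermite_fun n x)\<^sup>2 \<le> ((hermite_norm n)\<^sup>2 * C\<^sup>2 * exp (q\<^sup>2)) * exp (- x)" if "x \<ge> 0" for x
  proof -
    have "(hermite_fun n x)\<^sup>2 = (hermite_norm n)\<^sup>2 * (exp (- x\<^sup>2 / 2))\<^sup>2 * \<bar>poly (hermite_poly n) x\<bar>\<^sup>2"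
      by (simp only: hermite_fun_poly power_mult_distrib power2_abs)
    also have "\<dots> \<le> (hermite_norm n)\<^sup>2 * (exp (- x\<^sup>2 / 2))\<^sup>2 * (C * exp (real k * x))\<^sup>2"
      using Ck[OF that] by (intro mult_left_mono power_mono) auto
    also have "\<dots> = (hermite_norm n)\<^sup>2 * C\<^sup>2 * exp (2 * real k * x - x\<^sup>2)"
      by (simp add: power_mult_distrib exp_of_nat_mult[symmetric] exp_double[symmetric] exp_diff exp_minus field_simps)
    also have "\<dots> \<le> (hermite_norm n)\<^sup>2 * C\<^sup>2 * exp (q\<^sup>2 - x)"
    proof (intro mult_left_mono)
      have "0 \<le> (x - q)\<^sup>2" by simp
      also have "\<dots> = x\<^sup>2 - 2 * q * x + q\<^sup>2" by (simp add: power2_eq_square algebra_simps)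
      also have "2 * q * x = 2 * real k * x + x" by (simp add: q_def algebra_simps)
      finally show "exp (2 * real k * x - x\<^sup>2) \<le> exp (q\<^sup>2 - x)" by simp
    qed auto
    also have "\<dots> = ((hermite_norm n)\<^sup>2 * C\<^sup>2 * exp (q\<^sup>2)) * exp (- x)"
      by (simp only: exp_diff exp_minus divide_inverse mult.assoc)
    finally show ?thesis .
  qed
  then show ?thesis by blast
qed

lemma continuous_on_hermite_fun: "continuous_on S (hermite_fun n)"
  by (rule DERIV_continuous_on[OF hermite_fun_raise])

text \<open>Agreement is asked for on the positive axis only, as functions on the half axis are
  arbitrary elsewhere; the factor \<open>c\<close> also admits the zero function.\<close>

lemma square_integrable_hermite_fun:
  assumes "\<And>x. x > 0 \<Longrightarrow> g x = c * complex_of_real (hermite_fun n x)"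
  shows "square_integrable_half_axis g"
proof -
  have cont: "continuous_on {0<..} (\<lambda>x. c * complex_of_real (hermite_fun n x))"
    by (intro continuous_intros continuous_on_hermite_fun)
  then have "continuous_on {0<..} g"
    by (rule continuous_on_eq) (simp add: assms)
  then have meas: "g \<in> borel_measurable (lebesgue_on {0<..})"
    by (intro continuous_imp_measurable_on_sets_lebesgue) auto
  obtain C where C: "\<And>x. x \<ge> 0 \<Longrightarrow> (hermite_fun n x)\<^sup>2 \<le> C * exp (- x)"
    using hermite_fun_square_le by blast
  have "(\<lambda>x. exp (- x) :: real) integrable_on {0..}"
    using integrable_on_exp_minus_to_infinity[of 1 0] by simp
  then have "(\<lambda>x. exp (- x) :: real) absolutely_integrable_on {0..}"
    by (intro nonnegative_absolutely_integrable_1) auto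
  then have "(\<lambda>x. exp (- x) :: real) absolutely_integrable_on {0<..}"
    by (rule set_integrable_subset) auto
  then have "integrable (lebesgue_on {0<..}) (\<lambda>x. exp (- x) :: real)"
    by (simp add: integrable_restrict_space set_integrable_def)
  then have "integrable (lebesgue_on {0<..}) (\<lambda>x. (cmod c)\<^sup>2 * C * exp (- x))"
    by (intro integrable_mult_right)
  then have "integrable (lebesgue_on {0<..}) (\<lambda>x. (cmod (g x))\<^sup>2)"
  proof (rule Bochner_Integration.integrable_bound)
    show "(\<lambda>x. (cmod (g x))\<^sup>2) \<in> borel_measurable (lebesgue_on {0<..})"
      using meas by measurable
    show "AE x in lebesgue_on {0<..}. norm ((cmod (g x))\<^sup>2) \<le> norm ((cmod c)\<^sup>2 * C * exp (- x))"
    proof (rule AE_I2)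
      fix x :: real assume "x \<in> space (lebesgue_on {0<..})"
      then have "x > 0" by simp
      have "(cmod (g x))\<^sup>2 = (cmod c)\<^sup>2 * (hermite_fun n x)\<^sup>2"
        using assms[OF \<open>x > 0\<close>] by (simp add: norm_mult power_mult_distrib)
      also have "\<dots> \<le> (cmod c)\<^sup>2 * (C * exp (- x))"
        using C[of x] \<open>x > 0\<close> by (intro mult_left_mono) auto
      finally show "norm ((cmod (g x))\<^sup>2) \<le> norm ((cmod c)\<^sup>2 * C * exp (- x))"
        by (simp add: mult.assoc)
    qed
  qed
  with meas show ?thesis by (simp add: square_integrable_half_axis_def)
qed

section \<open>The harmonic oscillator on the half line\<close>

text \<open>A mean value estimate in the one-sided setting; \<open>d = 0\<close> gives monotonicity,
  \<open>d > 0\<close> linear growth.\<close>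

lemma half_line_increment_ge:
  fixes F :: "real \<Rightarrow> real"
  assumes der: "\<And>x. x \<ge> 0 \<Longrightarrow> (F has_real_derivative F' x) (at x within {0..})"
    and "0 \<le> s" "s \<le> t" and ge: "\<And>x. \<lbrakk>s \<le> x; x \<le> t\<rbrakk> \<Longrightarrow> d \<le> F' x"
  shows "d * (t - s) \<le> F t - F s"
proof -
  have "\<exists>x\<in>{s..t}. F t - F s = F' x * (t - s)"
  proof (rule mvt_very_simple[OF \<open>s \<le> t\<close>, where f' = "\<lambda>x h. F' x * h"])
    fix x assume "s \<le> x" "x \<le> t"
    then have "(F has_real_derivative F' x) (at x within {s..t})"
      using \<open>0 \<le> s\<close> by (intro has_field_derivative_subset[OF der]) auto
    then show "(F has_derivative (*) (F' x)) (at x within {s..t})"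
      by (simp add: has_field_derivative_def)
  qed
  then show ?thesis using ge \<open>s \<le> t\<close> by (auto intro!: mult_right_mono)
qed

lemma has_vector_derivative_complex_of_real:
  "(f has_real_derivative d) F \<Longrightarrow> ((\<lambda>x. complex_of_real (f x)) has_vector_derivative of_real d) F"
  by (intro has_vector_derivative_of_real) (simp add: has_real_derivative_iff_has_vector_derivative)

text \<open>For continuous \<open>f\<close> this is square integrability on the half line, expressed
  by a bounded primitive of |f|^2. In this form the arguments on the differential equation are pure
  calculus.\<close>

definition finite_energy :: "(real \<Rightarrow> complex) \<Rightarrow> bool" where
  "finite_energy f \<longleftrightarrow>
    (\<exists>P M. \<forall>x\<ge>0. (P has_real_derivative (cmod (f x))\<^sup>2) (at x within {0..}) \<and> P x \<le> M)"

lemma finite_energy_not_bounded_below: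
  assumes "finite_energy f" "e > 0" "s \<ge> 0"
  shows "\<exists>x\<ge>s. (cmod (f x))\<^sup>2 < e"
proof (rule ccontr)
  assume "\<not> ?thesis"
  then have ge: "\<And>x. x \<ge> s \<Longrightarrow> e \<le> (cmod (f x))\<^sup>2" by force
  obtain P M where P: "\<And>x. x \<ge> 0 \<Longrightarrow> (P has_real_derivative (cmod (f x))\<^sup>2) (at x within {0..})"
    and M: "\<And>x. x \<ge> 0 \<Longrightarrow> P x \<le> M"
    using assms(1) unfolding finite_energy_def by blast
  \<comment> \<open>Chosen so that growth at rate \<open>e\<close> from \<open>s\<close> carries the
    primitive to at least \<open>M + 1\<close>.\<close>
  define t where "t = s + (M - P s + 1) / e"
  have "P s \<le> M" using M assms by auto
  then have "s \<le> t" using assms by (auto simp: t_def)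
  have "e * (t - s) \<le> P t - P s"
    by (rule half_line_increment_ge[OF P]) (use assms \<open>s \<le> t\<close> ge in auto)
  moreover have "e * (t - s) = M - P s + 1" using assms by (simp add: t_def)
  moreover have "P t \<le> M" using M \<open>s \<le> t\<close> assms by auto
  ultimately show False by simp
qed

text \<open>Integrating factor. The case \<open>k = -1\<close> gives the ground state,
  \<open>k = 1\<close> the growing solution that arises at the Dirac eigenvalue 0.\<close>

lemma gaussian_ode_unique:
  fixes f :: "real \<Rightarrow> complex" and k :: real
  assumes "\<And>x. x \<ge> 0 \<Longrightarrow> (f has_vector_derivative of_real (k * x) * f x) (at x within {0..})"
    and "x \<ge> 0"
  shows "f x = f 0 * of_real (exp (k * x\<^sup>2 / 2))"
proof -
  define g where "g = (\<lambda>x. exp (- k * x\<^sup>2 / 2) *\<^sub>R f x)"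
  have "(g has_vector_derivative 0) (at x within {0..})" if "x \<in> {0..}" for x
  proof -
    have e: "((\<lambda>x. exp (- k * x\<^sup>2 / 2)) has_real_derivative (- k * x) * exp (- k * x\<^sup>2 / 2)) (at x within {0..})"
      by (auto intro!: derivative_eq_intros)
    have "(g has_vector_derivative exp (- k * x\<^sup>2 / 2) *\<^sub>R (of_real (k * x) * f x)
        + ((- k * x) * exp (- k * x\<^sup>2 / 2)) *\<^sub>R f x) (at x within {0..})"
      unfolding g_def using that assms(1) by (intro has_vector_derivative_scaleR e) auto
    then show ?thesis by (simp add: scaleR_conv_of_real algebra_simps)
  qed
  then obtain c where c: "\<And>x. x \<in> {0..} \<Longrightarrow> g x = c"
    using has_vector_derivative_zero_constant[of "{0..}" g] by auto
  have "g 0 = g x" using c[of x] c[of 0] assms(2) by simp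
  then have "f 0 = exp (- k * x\<^sup>2 / 2) *\<^sub>R f x" by (simp add: g_def)
  then have "exp (k * x\<^sup>2 / 2) *\<^sub>R f 0 = f x" by (simp add: exp_add[symmetric])
  then show ?thesis by (simp add: scaleR_conv_of_real mult.commute)
qed

section \<open>Energy identities and the annihilation operator\<close>

lemma norm_square_deriv:
  fixes f :: "real \<Rightarrow> complex"
  assumes "(f has_vector_derivative f') (at x within S)"
  shows "((\<lambda>x. (cmod (f x))\<^sup>2) has_real_derivative 2 * (f' \<bullet> f x)) (at x within S)"
proof -
  have "((\<lambda>x. f x \<bullet> f x) has_vector_derivative f x \<bullet> f' + f' \<bullet> f x) (at x within S)"
    by (rule bounded_bilinear.has_vector_derivative[OF bounded_bilinear_inner assms assms])
  then show ?thesis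
    by (simp add: has_real_derivative_iff_has_vector_derivative power2_norm_eq_inner inner_commute)
qed

text \<open>In the real inner product of the complex plane, multiplication by an imaginary number
  maps z to a vector orthogonal to z, so the imaginary part of \<mu> drops out of the energy
  estimates.\<close>

lemma inner_mult_self: "((of_real r - \<mu>) * z) \<bullet> z = (r - Re \<mu>) * (cmod z)\<^sup>2" for z :: complex
  unfolding cmod_power2 inner_complex_def by (simp add: power2_eq_square algebra_simps)

text \<open>Makes derivatives within the half line unique, including at the endpoint 0.\<close>

lemma at_within_half_line_neq_bot: "x \<ge> 0 \<Longrightarrow> at x within {0..} \<noteq> bot" for x :: real
proof -
  assume "x \<ge> 0"
  then have "at_right x \<le> at x within {0..}" by (intro at_le) auto
  then show ?thesis using trivial_limit_at_right_real[of x] by (auto simp: bot_unique)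
qed

text \<open>The shift by 1 puts the ground state exp(-x^2/2) at \<mu> = 0 and phi_n at \<mu> = 2n,
  the square of the corresponding Dirac eigenvalue.\<close>

locale oscillator_solution =
  fixes f f' :: "real \<Rightarrow> complex" and \<mu> :: complex
  assumes der: "\<And>x. x \<ge> 0 \<Longrightarrow> (f has_vector_derivative f' x) (at x within {0..})"
    and der': "\<And>x. x \<ge> 0 \<Longrightarrow> (f' has_vector_derivative (of_real (x\<^sup>2 - 1) - \<mu>) * f x) (at x within {0..})"
    and energy: "finite_energy f"
    and boundary: "f 0 = 0 \<or> f' 0 = 0"
begin

lemma norm_square_f:
  "x \<ge> 0 \<Longrightarrow> ((\<lambda>x. (cmod (f x))\<^sup>2) has_real_derivative 2 * (f' x \<bullet> f x)) (at x within {0..})"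
  by (intro norm_square_deriv der)

text \<open>Since f' . f is half the derivative of |f|^2, its own derivative measures the convexity
  of |f|^2.\<close>

lemma inner_f'_f:
  assumes "x \<ge> 0"
  shows "((\<lambda>x. f' x \<bullet> f x) has_real_derivative (cmod (f' x))\<^sup>2 + (x\<^sup>2 - 1 - Re \<mu>) * (cmod (f x))\<^sup>2)
    (at x within {0..})"
proof -
  have "((\<lambda>x. f' x \<bullet> f x) has_vector_derivative f' x \<bullet> f' x + ((of_real (x\<^sup>2 - 1) - \<mu>) * f x) \<bullet> f x)
      (at x within {0..})"
    by (rule bounded_bilinear.has_vector_derivative[OF bounded_bilinear_inner der'[OF assms] der[OF assms]])
  then show ?thesis
    unfolding inner_mult_self by (simp add: has_real_derivative_iff_has_vector_derivative power2_norm_eq_inner)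
qed

lemma zero_if_Re_le:
  assumes "Re \<mu> \<le> -1" "x \<ge> 0"
  shows "f x = 0"
proof (rule ccontr)
  assume "f x \<noteq> 0"
  have nonneg: "0 \<le> f' t \<bullet> f t" if "t \<ge> 0" for t
  proof -
    have "0 * (t - 0) \<le> f' t \<bullet> f t - f' 0 \<bullet> f 0"
      by (rule half_line_increment_ge[OF inner_f'_f])
        (use that assms in \<open>auto intro!: add_nonneg_nonneg mult_nonneg_nonneg order_trans[OF assms(1)]\<close>)
    then show ?thesis using boundary by auto
  qed
  have "(cmod (f x))\<^sup>2 \<le> (cmod (f t))\<^sup>2" if "t \<ge> x" for t
  proof -
    have "0 * (t - x) \<le> (cmod (f t))\<^sup>2 - (cmod (f x))\<^sup>2"
      by (rule half_line_increment_ge[OF norm_square_f]) (use that assms nonneg in auto)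
    then show ?thesis by simp
  qed
  moreover obtain t where "t \<ge> x" "(cmod (f t))\<^sup>2 < (cmod (f x))\<^sup>2"
    using finite_energy_not_bounded_below[OF energy _ assms(2), of "(cmod (f x))\<^sup>2"] \<open>f x \<noteq> 0\<close> by auto
  ultimately show False by (meson not_le)
qed

abbreviation lowered :: "real \<Rightarrow> complex" where
  "lowered x \<equiv> f' x + of_real x * f x"

text \<open>In the derivative of \<open>lowered\<close> the -f from the equation cancels the f from
  the product rule for x f.\<close>

abbreviation lowered' :: "real \<Rightarrow> complex" where
  "lowered' x \<equiv> (of_real (x\<^sup>2) - \<mu>) * f x + of_real x * f' x"

text \<open>Two primitives are at work: \<open>N\<close> for |f'|^2 + x^2 |f|^2, bounded above by
  contradiction, and \<open>Q\<close> for |f' + x f|^2, controlled by \<open>2 * N\<close>.\<close>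

lemma finite_energy_lowered: "finite_energy lowered"
proof -
  obtain P M where P: "\<And>x. x \<ge> 0 \<Longrightarrow> (P has_real_derivative (cmod (f x))\<^sup>2) (at x within {0..})"
    and M: "\<And>x. x \<ge> 0 \<Longrightarrow> P x \<le> M"
    using energy unfolding finite_energy_def by blast
  have PM: "\<bar>P x\<bar> \<le> \<bar>P 0\<bar> + \<bar>M\<bar>" if "x \<ge> 0" for x
  proof -
    have "0 * (x - 0) \<le> P x - P 0"
      by (rule half_line_increment_ge[OF P]) (use that in auto)
    then show ?thesis using M[OF that] by linarith
  qed
  \<comment> \<open>The coefficient that cancels the term - (1 + Re \<mu>) |f|^2 and leaves
    \<open>N\<close> with a nonnegative derivative.\<close>
  define a where "a = 1 + Re \<mu>"
  define N where "N = (\<lambda>x. f' x \<bullet> f x + a * P x)"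
  have N: "(N has_real_derivative (cmod (f' x))\<^sup>2 + x\<^sup>2 * (cmod (f x))\<^sup>2) (at x within {0..})" if "x \<ge> 0" for x
    unfolding N_def
    by (rule DERIV_cong[OF DERIV_add[OF inner_f'_f[OF that] DERIV_cmult[OF P[OF that]]]])
      (simp add: a_def algebra_simps)
  \<comment> \<open>A bound for \<open>a * P\<close>, so that \<open>N\<close> above
    \<open>K + 1\<close> forces f' . f above 1.\<close>
  define K where "K = \<bar>a\<bar> * (\<bar>P 0\<bar> + \<bar>M\<bar>)"
  have aP: "a * P x \<le> K" if "x \<ge> 0" for x
  proof -
    have "a * P x \<le> \<bar>a\<bar> * \<bar>P x\<bar>" by (metis abs_ge_self abs_mult)
    also have "\<dots> \<le> K" unfolding K_def using PM[OF that] by (intro mult_left_mono) auto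
    finally show ?thesis .
  qed
  \<comment> \<open>Past a point where \<open>N > K + 1\<close>, the derivative of \<open>\<bar>f\<bar>\<^sup>2\<close> would stay above \<open>2\<close>.\<close>
  have NK: "N s \<le> K + 1" if "s \<ge> 0" for s
  proof (rule ccontr)
    assume large: "\<not> N s \<le> K + 1"
    have "1 \<le> f' t \<bullet> f t" if "t \<ge> s" for t
    proof -
      have "0 * (t - s) \<le> N t - N s"
        by (rule half_line_increment_ge[OF N]) (use that \<open>s \<ge> 0\<close> in auto)
      then show ?thesis using large aP[of t] that \<open>s \<ge> 0\<close> by (simp add: N_def)
    qed
    then have "2 * (t - s) \<le> (cmod (f t))\<^sup>2 - (cmod (f s))\<^sup>2" if "t \<ge> s" for t
      by (intro half_line_increment_ge[OF norm_square_f]) (use that \<open>s \<ge> 0\<close> in auto)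
    then have "2 \<le> (cmod (f t))\<^sup>2" if "t \<ge> s + 1" for t
      using that by (smt (verit) zero_le_power2)
    moreover obtain t where "t \<ge> s + 1" "(cmod (f t))\<^sup>2 < 2"
      using finite_energy_not_bounded_below[OF energy, of 2 "s + 1"] \<open>s \<ge> 0\<close> by auto
    ultimately show False by (meson not_le)
  qed
  \<comment> \<open>The cross term 2 x f' . f is integrated by parts: x |f|^2 minus the primitive
    \<open>P\<close> of |f|^2 is a primitive of it.\<close>
  define Q where "Q = (\<lambda>x. N x + (x * (cmod (f x))\<^sup>2 - P x))"
  have Q: "(Q has_real_derivative (cmod (lowered x))\<^sup>2) (at x within {0..})" if "x \<ge> 0" for x
  proof -
    have "((\<lambda>x. x * (cmod (f x))\<^sup>2) has_real_derivative 1 * (cmod (f x))\<^sup>2 + 2 * (f' x \<bullet> f x) * x) (at x within {0..})"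
      by (rule DERIV_mult[OF DERIV_ident norm_square_f[OF that]])
    then have "(Q has_real_derivative (cmod (f' x))\<^sup>2 + x\<^sup>2 * (cmod (f x))\<^sup>2
        + ((1 * (cmod (f x))\<^sup>2 + 2 * (f' x \<bullet> f x) * x) - (cmod (f x))\<^sup>2)) (at x within {0..})"
      unfolding Q_def by (intro DERIV_add DERIV_diff N P that)
    moreover have "(cmod (lowered x))\<^sup>2 = (cmod (f' x))\<^sup>2 + x\<^sup>2 * (cmod (f x))\<^sup>2 + 2 * (f' x \<bullet> f x) * x"
      unfolding cmod_power2 inner_complex_def by (simp add: power2_eq_square algebra_simps)
    ultimately show ?thesis by (simp add: algebra_simps)
  qed
  have "Q x \<le> 2 * (K + 1) - 2 * N 0 + Q 0" if "x \<ge> 0" for x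
  proof -
    \<comment> \<open>\<open>2 * N - Q\<close> is nondecreasing: by the parallelogram law its
      derivative is |f' - x f|^2.\<close>
    have "0 * (x - 0) \<le> (2 * N x - Q x) - (2 * N 0 - Q 0)"
    proof (rule half_line_increment_ge[OF DERIV_diff[OF DERIV_cmult[OF N] Q]])
      fix t :: real
      have "(cmod (f' t + of_real t * f t))\<^sup>2 + (cmod (f' t - of_real t * f t))\<^sup>2
          = 2 * ((cmod (f' t))\<^sup>2 + t\<^sup>2 * (cmod (f t))\<^sup>2)"
        unfolding cmod_power2 by (simp add: power2_eq_square algebra_simps)
      then show "0 \<le> 2 * ((cmod (f' t))\<^sup>2 + t\<^sup>2 * (cmod (f t))\<^sup>2) - (cmod (lowered t))\<^sup>2"
        by (smt (verit) zero_le_power2)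
    qed (use that in auto)
    then show ?thesis using NK[OF that] by simp
  qed
  with Q show ?thesis unfolding finite_energy_def by blast
qed

lemma lowered_deriv:
  assumes "x \<ge> 0"
  shows "(lowered has_vector_derivative lowered' x) (at x within {0..})"
proof -
  have "((\<lambda>x. complex_of_real x * f x) has_vector_derivative of_real x * f' x + of_real 1 * f x) (at x within {0..})"
    by (intro has_vector_derivative_mult has_vector_derivative_of_real der assms) (rule derivative_intros)
  from has_vector_derivative_add[OF der'[OF assms] this] show ?thesis
    by (simp add: algebra_simps)
qed

text \<open>This is the commutation relation A H = (H + 2) A for A = d/dx + x and H = -d^2/dx^2 +
  x^2, where \<open>f\<close> has H-eigenvalue \<mu> + 1.\<close>

lemma oscillator_solution_lowered: "oscillator_solution lowered lowered' (\<mu> - 2)"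
proof
  show "(lowered has_vector_derivative lowered' x) (at x within {0..})" if "x \<ge> 0" for x
    by (rule lowered_deriv[OF that])
  show "(lowered' has_vector_derivative (of_real (x\<^sup>2 - 1) - (\<mu> - 2)) * lowered x) (at x within {0..})"
    if "x \<ge> 0" for x
  proof -
    have "((\<lambda>x. complex_of_real x * f' x) has_vector_derivative
        of_real x * ((of_real (x\<^sup>2 - 1) - \<mu>) * f x) + of_real 1 * f' x) (at x within {0..})"
      by (intro has_vector_derivative_mult has_vector_derivative_of_real der' that) (rule derivative_intros)
    moreover have "((\<lambda>x. complex_of_real (x\<^sup>2) - \<mu>) has_vector_derivative of_real (2 * x)) (at x within {0..})"
    proof -
      have "((\<lambda>x. x\<^sup>2) has_real_derivative 2 * x) (at x within {0..})"
        by (auto intro!: derivative_eq_intros)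
      from has_vector_derivative_diff[OF has_vector_derivative_complex_of_real[OF this] has_vector_derivative_const] show ?thesis by simp
    qed
    then have "((\<lambda>x. (complex_of_real (x\<^sup>2) - \<mu>) * f x) has_vector_derivative
        (of_real (x\<^sup>2) - \<mu>) * f' x + of_real (2 * x) * f x) (at x within {0..})"
      by (intro has_vector_derivative_mult der that)
    ultimately have "(lowered' has_vector_derivative
        ((of_real (x\<^sup>2) - \<mu>) * f' x + of_real (2 * x) * f x) +
        (of_real x * ((of_real (x\<^sup>2 - 1) - \<mu>) * f x) + of_real 1 * f' x)) (at x within {0..})"
      by (intro has_vector_derivative_add)
    then show ?thesis by (simp add: algebra_simps)
  qed
  show "finite_energy lowered" by (rule finite_energy_lowered)
  show "lowered 0 = 0 \<or> lowered' 0 = 0" using boundary by auto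
qed

lemma gaussian_if_lowered_zero:
  assumes "\<And>x. x \<ge> 0 \<Longrightarrow> lowered x = 0"
  shows "(\<forall>x\<ge>0. f x = 0) \<or> \<mu> = 0 \<and> (\<exists>c. \<forall>x\<ge>0. f x = c * of_real (hermite_fun 0 x))"
proof -
  have f': "f' x = of_real (-1 * x) * f x" if "x \<ge> 0" for x
    using assms[OF that] by (simp add: eq_neg_iff_add_eq_0)
  have f: "f x = f 0 * of_real (exp (-1 * x\<^sup>2 / 2))" if "x \<ge> 0" for x
    using der f' that by (intro gaussian_ode_unique) auto
  \<comment> \<open>As \<open>lowered' 0\<close> is - \<mu> f(0), the vanishing of
    \<open>lowered\<close> forces \<mu> = 0 unless the Gaussian itself is zero.\<close>
  have "lowered' 0 = 0"
  proof (rule vector_derivative_unique_within[OF _ lowered_deriv])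
    have "((\<lambda>_. 0) has_vector_derivative 0) (at 0 within {0..})" by simp
    then show "(lowered has_vector_derivative 0) (at 0 within {0..})"
      by (rule has_vector_derivative_transform[rotated 2]) (use assms in auto)
  qed (auto simp: at_within_half_line_neq_bot)
  then have "\<mu> = 0 \<or> f 0 = 0" by simp
  moreover have "f x = (f 0 / of_real (hermite_norm 0)) * of_real (hermite_fun 0 x)" if "x \<ge> 0" for x
    using f[OF that] by (simp add: hermite_fun_0)
  moreover have "\<forall>x\<ge>0. f x = 0" if "f 0 = 0" using f that by (metis mult_zero_left)
  ultimately show ?thesis by blast
qed

end

theorem oscillator_eigenfunctions:
  assumes "oscillator_solution f f' \<mu>"
  shows "(\<forall>x\<ge>0. f x = 0) \<or>
    (\<exists>n c. \<mu> = of_nat (2 * n) \<and> (\<forall>x\<ge>0. f x = c * of_real (hermite_fun n x)))"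
proof -
  \<comment> \<open>\<open>m\<close> bounds the number of lowerings: each takes 2 from Re \<mu>, and
    at \<open>m = 0\<close> the bound reads Re \<mu> < -1, where only the zero solution
    remains.\<close>
  have "(\<forall>x\<ge>0. f x = 0) \<or>
    (\<exists>n c. \<mu> = of_nat (2 * n) \<and> (\<forall>x\<ge>0. f x = c * of_real (hermite_fun n x)))"
    if "oscillator_solution f f' \<mu>" "Re \<mu> < 2 * real m - 1" for m
    using that
  proof (induction m arbitrary: f f' \<mu>)
    case 0
    then show ?case using oscillator_solution.zero_if_Re_le[OF 0(1)] by auto
  next
    case (Suc m)
    interpret oscillator_solution f f' \<mu> by (rule Suc.prems(1))
    have "Re (\<mu> - 2) < 2 * real m - 1" using Suc.prems(2) by simp
    from Suc.IH[OF oscillator_solution_lowered this]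
    show ?case
    proof (elim disjE exE conjE)
      assume "\<forall>x\<ge>0. lowered x = 0"
      then have "(\<forall>x\<ge>0. f x = 0) \<or> \<mu> = 0 \<and> (\<exists>c. \<forall>x\<ge>0. f x = c * of_real (hermite_fun 0 x))"
        by (intro gaussian_if_lowered_zero) simp
      moreover have "(0::complex) = of_nat (2 * 0)" by simp
      ultimately show ?thesis by blast
    next
      fix n c
      assume mu: "\<mu> - 2 = of_nat (2 * n)" and c: "\<forall>x\<ge>0. lowered x = c * of_real (hermite_fun n x)"
      have mu': "\<mu> = of_nat (2 * Suc n)" using mu by (simp add: diff_eq_eq)
      have "\<mu> \<noteq> 0" unfolding mu' of_nat_eq_0_iff by simp
      define r where "r = sqrt (2 * real (Suc n))"
      have "f x = (c * of_real r / \<mu>) * of_real (hermite_fun (Suc n) x)" if "x \<ge> 0" for x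
      proof -
        have "lowered' x = c * of_real (x * hermite_fun n x - r * hermite_fun (Suc n) x)"
        proof (rule vector_derivative_unique_within[OF _ lowered_deriv])
          have "((\<lambda>x. c * of_real (hermite_fun n x)) has_vector_derivative
              c * of_real (x * hermite_fun n x - r * hermite_fun (Suc n) x)) (at x within {0..})"
            unfolding r_def
            by (intro has_vector_derivative_mult_right has_vector_derivative_complex_of_real hermite_fun_raise)
          then show "(lowered has_vector_derivative
              c * of_real (x * hermite_fun n x - r * hermite_fun (Suc n) x)) (at x within {0..})"
            by (rule has_vector_derivative_transform[rotated 2]) (use c that in auto)
          show "at x within {0..} \<noteq> bot"
            using that by (rule at_within_half_line_neq_bot)
        qed (rule that)
        \<comment> \<open>The creation operator x - d/dx applied to \<open>lowered\<close> returns
          \<mu> f, so \<open>f\<close> is found by dividing by the nonzero \<mu>.\<close>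
        moreover have "\<mu> * f x = of_real x * lowered x - lowered' x"
          by (simp add: algebra_simps power2_eq_square)
        ultimately have "\<mu> * f x = of_real x * (c * of_real (hermite_fun n x))
            - c * of_real (x * hermite_fun n x - r * hermite_fun (Suc n) x)"
          using c that by simp
        also have "\<dots> = c * of_real r * of_real (hermite_fun (Suc n) x)"
          unfolding of_real_diff of_real_mult by (simp only: algebra_simps)
        finally have "f x = c * of_real r * of_real (hermite_fun (Suc n) x) / \<mu>"
          using nonzero_mult_div_cancel_left[OF \<open>\<mu> \<noteq> 0\<close>] by metis
        then show ?thesis by simp
      qed
      then show ?thesis using mu' by blast
    qed
  qed
  moreover obtain m where "Re \<mu> < 2 * real m - 1"
  proof -
    obtain m where "Re \<mu> + 1 < real m" using reals_Archimedean2 by blast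
    then have "Re \<mu> < 2 * real m - 1" by linarith
    then show thesis by (rule that)
  qed
  ultimately show ?thesis using assms by blast
qed

section \<open>The Dirac system\<close>

text \<open>One sequence for both operators: the number attached to U_n before any boundary
  condition is imposed. The boundary conditions then select the even or the odd indices.\<close>

definition dirac_eig :: "int \<Rightarrow> real" where
  "dirac_eig n = sqrt (2 * of_int \<bar>n\<bar>) * of_int (sgn n)"

lemma dirac_eig_0 [simp]: "dirac_eig 0 = 0"
  and dirac_eig_pos [simp]: "dirac_eig (int (Suc m)) = sqrt (2 * real (Suc m))"
  and dirac_eig_neg [simp]: "dirac_eig (- int (Suc m)) = - sqrt (2 * real (Suc m))"
  by (simp_all add: dirac_eig_def)

text \<open>The successor form on both sides removes truncated subtraction from the index shift in
  \<open>U\<close>.\<close>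

lemma int_cases_Suc:
  obtains "n = 0" | m where "n = int (Suc m)" | m where "n = - int (Suc m)"
proof (cases n rule: int_cases3)
  case (pos k)
  then show thesis using that(2)[of "k - 1"] by simp
next
  case (neg k)
  then show thesis using that(3)[of "k - 1"] by simp
qed (rule that(1))

lemma inj_dirac_eig: "inj dirac_eig"
proof (rule injI)
  \<comment> \<open>The product with the absolute value keeps the sign that squaring would lose, so
    \<open>n\<close> can be read off.\<close>
  have *: "dirac_eig n * \<bar>dirac_eig n\<bar> = 2 * of_int n" for n
    by (cases n rule: int_cases_Suc) (simp_all del: of_nat_Suc)
  fix m n assume "dirac_eig m = dirac_eig n"
  then have "2 * real_of_int m = 2 * of_int n" by (simp only: *[symmetric])
  then show "m = n" by simp
qed

lemma U_0: "U 0 x $ 1 = 0" "U 0 x $ 2 = of_real (hermite_fun 0 x)"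
  and U_pos: "U (int (Suc m)) x $ 1 = of_real (hermite_fun m x)"
    "U (int (Suc m)) x $ 2 = of_real (hermite_fun (Suc m) x)"
  and U_neg: "U (- int (Suc m)) x $ 1 = - of_real (hermite_fun m x)"
    "U (- int (Suc m)) x $ 2 = of_real (hermite_fun (Suc m) x)"
proof -
  have "nat (- (- int (Suc m))) = Suc m" "nat (int (Suc m)) = Suc m" by simp_all
  then show "U 0 x $ 1 = 0" "U 0 x $ 2 = of_real (hermite_fun 0 x)"
    "U (int (Suc m)) x $ 1 = of_real (hermite_fun m x)"
    "U (int (Suc m)) x $ 2 = of_real (hermite_fun (Suc m) x)"
    "U (- int (Suc m)) x $ 1 = - of_real (hermite_fun m x)"
    "U (- int (Suc m)) x $ 2 = of_real (hermite_fun (Suc m) x)"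
    unfolding U_def by (simp_all del: of_nat_Suc)
qed

lemmas U_components = U_0 U_pos U_neg

text \<open>For nonzero n the components are, up to sign, consecutive Hermite functions, exactly one
  of which is odd; for n = 0 the first is zero and the second a Gaussian. So exactly one component
  vanishes at 0.\<close>

lemma U_at_0: "U n 0 $ 1 = 0 \<longleftrightarrow> even n" "U n 0 $ 2 = 0 \<longleftrightarrow> odd n"
proof -
  have "(U n 0 $ 1 = 0 \<longleftrightarrow> even n) \<and> (U n 0 $ 2 = 0 \<longleftrightarrow> odd n)"
  proof (cases n rule: int_cases_Suc)
    case 1
    then show ?thesis by (simp add: U_components hermite_fun_at_0)
  next
    case (2 m)
    have "even n \<longleftrightarrow> odd m" unfolding 2 by simp
    then show ?thesis unfolding 2 U_components by (simp add: hermite_fun_at_0)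
  next
    case (3 m)
    have "even n \<longleftrightarrow> odd m" unfolding 3 by simp
    then show ?thesis unfolding 3 U_components by (simp add: hermite_fun_at_0)
  qed
  then show "U n 0 $ 1 = 0 \<longleftrightarrow> even n" "U n 0 $ 2 = 0 \<longleftrightarrow> odd n" by simp_all
qed

text \<open>The Dirac system solved for the derivatives. Raising gives the first component and
  lowering the second; changing the sign of the first component changes the sign of the
  eigenvalue.\<close>

lemma U_deriv:
  "((\<lambda>x. U n x $ 1) has_vector_derivative of_real x * U n x $ 1 - of_real (dirac_eig n) * U n x $ 2) (at x within S)"
  "((\<lambda>x. U n x $ 2) has_vector_derivative of_real (dirac_eig n) * U n x $ 1 - of_real x * U n x $ 2) (at x within S)"
proof -
  note raise = has_vector_derivative_complex_of_real[OF hermite_fun_raise]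
  note lower = has_vector_derivative_complex_of_real[OF hermite_fun_lower]
  show "((\<lambda>x. U n x $ 1) has_vector_derivative of_real x * U n x $ 1 - of_real (dirac_eig n) * U n x $ 2) (at x within S)"
  proof (cases n rule: int_cases_Suc)
    case (2 m)
    then show ?thesis using raise[of m x S] by (simp add: U_components del: of_nat_Suc)
  next
    case (3 m)
    then show ?thesis using has_vector_derivative_minus[OF raise[of m x S]]
      by (simp add: U_components del: of_nat_Suc)
  qed (simp add: U_components)
  show "((\<lambda>x. U n x $ 2) has_vector_derivative of_real (dirac_eig n) * U n x $ 1 - of_real x * U n x $ 2) (at x within S)"
  proof (cases n rule: int_cases_Suc)
    case 1
    then show ?thesis using has_vector_derivative_complex_of_real[OF hermite_fun_0_deriv[of x S]]
      by (simp add: U_components)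
  next
    case (2 m)
    then show ?thesis using lower[of m x S] by (simp add: U_components del: of_nat_Suc)
  next
    case (3 m)
    then show ?thesis using lower[of m x S] by (simp add: U_components del: of_nat_Suc)
  qed
qed

lemma continuous_on_U: "continuous_on S (\<lambda>x. U n x $ k)"
proof (cases "k = 1")
  case True
  then show ?thesis using continuous_on_vector_derivative[OF U_deriv(1)] by simp
next
  case False
  then have "k = 2" using exhaust_2[of k] by simp
  then show ?thesis using continuous_on_vector_derivative[OF U_deriv(2)] by simp
qed

lemma square_integrable_U:
  assumes "\<And>x. x > 0 \<Longrightarrow> g x = c * U n x $ k"
  shows "square_integrable_half_axis g"
proof (cases n rule: int_cases_Suc)
  case 1
  show ?thesis
  proof (cases "k = 1")
    case True
    then show ?thesis using assms 1
      by (intro square_integrable_hermite_fun[of g 0 0]) (simp add: U_components)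
  next
    case False
    then show ?thesis using assms 1 exhaust_2[of k]
      by (intro square_integrable_hermite_fun[of g c 0]) (simp add: U_components)
  qed
next
  case (2 m)
  then show ?thesis using exhaust_2[of k] square_integrable_hermite_fun[of g c m]
      square_integrable_hermite_fun[of g c "Suc m"] assms
    by (auto simp: U_components simp del: of_nat_Suc)
next
  case (3 m)
  then show ?thesis using exhaust_2[of k] square_integrable_hermite_fun[of g "- c" m]
      square_integrable_hermite_fun[of g c "Suc m"] assms
    by (auto simp: U_components simp del: of_nat_Suc)
qed

text \<open>The elimination keeps \<open>y2\<close> because the second component of every U_n is
  phi_|n| itself; the sign of the eigenvalue shows in the first component.\<close>

theorem dirac_system_solutions:
  fixes y1 y2 :: "real \<Rightarrow> complex"
  assumes d1: "\<And>x. x \<ge> 0 \<Longrightarrow> (y1 has_vector_derivative of_real x * y1 x - \<mu> * y2 x) (at x within {0..})"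
    and d2: "\<And>x. x \<ge> 0 \<Longrightarrow> (y2 has_vector_derivative \<mu> * y1 x - of_real x * y2 x) (at x within {0..})"
    and energy: "finite_energy y1" "finite_energy y2"
    and boundary: "y1 0 = 0 \<or> y2 0 = 0"
    and nontrivial: "\<exists>x\<ge>0. y1 x \<noteq> 0 \<or> y2 x \<noteq> 0"
  shows "\<exists>n c. \<mu> = of_real (dirac_eig n) \<and> c \<noteq> 0 \<and> (\<forall>x\<ge>0. y1 x = c * U n x $ 1 \<and> y2 x = c * U n x $ 2)"
proof -
  have "\<exists>n c. \<mu> = of_real (dirac_eig n) \<and> (\<forall>x\<ge>0. y1 x = c * U n x $ 1 \<and> y2 x = c * U n x $ 2)"
  proof (cases "\<mu> = 0")
    case True
    \<comment> \<open>At \<mu> = 0 the system decouples into two first order equations with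
      solutions exp(x^2/2) and exp(-x^2/2); only the second has finite energy.\<close>
    have 1: "y1 x = y1 0 * of_real (exp (1 * x\<^sup>2 / 2))" if "x \<ge> 0" for x
      using d1 that by (intro gaussian_ode_unique) (auto simp: True)
    have 2: "y2 x = y2 0 * of_real (exp ((-1) * x\<^sup>2 / 2))" if "x \<ge> 0" for x
      using d2 that by (intro gaussian_ode_unique) (auto simp: True)
    have "y1 0 = 0"
    proof (rule ccontr)
      assume "y1 0 \<noteq> 0"
      then obtain x where x: "x \<ge> 0" "(cmod (y1 x))\<^sup>2 < (cmod (y1 0))\<^sup>2"
        using finite_energy_not_bounded_below[OF energy(1), of "(cmod (y1 0))\<^sup>2" 0] by auto
      have "cmod (y1 0) * 1 \<le> cmod (y1 0) * exp (1 * x\<^sup>2 / 2)"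
        by (intro mult_left_mono) auto
      also have "\<dots> = cmod (y1 x)"
        unfolding 1[OF x(1)] norm_mult norm_of_real by simp
      finally show False using x(2) by (simp add: power_mono leD)
    qed
    have "y1 x = (y2 0 / of_real (hermite_norm 0)) * U 0 x $ 1 \<and> y2 x = (y2 0 / of_real (hermite_norm 0)) * U 0 x $ 2"
      if "x \<ge> 0" for x
      using 1[OF that] 2[OF that] \<open>y1 0 = 0\<close> by (simp add: U_0 hermite_fun_0)
    then show ?thesis using True dirac_eig_0 by (metis of_real_0)
  next
    case False
    have "oscillator_solution y2 (\<lambda>x. \<mu> * y1 x - of_real x * y2 x) (\<mu>\<^sup>2)"
    proof
      fix x :: real assume x: "x \<ge> 0"
      show "(y2 has_vector_derivative \<mu> * y1 x - of_real x * y2 x) (at x within {0..})" by (rule d2[OF x])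
      have "((\<lambda>x. complex_of_real x * y2 x) has_vector_derivative
          of_real x * (\<mu> * y1 x - of_real x * y2 x) + of_real 1 * y2 x) (at x within {0..})"
        by (intro has_vector_derivative_mult has_vector_derivative_of_real d2 x) (rule derivative_intros)
      then have "((\<lambda>x. \<mu> * y1 x - of_real x * y2 x) has_vector_derivative
          \<mu> * (of_real x * y1 x - \<mu> * y2 x) - (of_real x * (\<mu> * y1 x - of_real x * y2 x) + of_real 1 * y2 x))
          (at x within {0..})"
        by (intro has_vector_derivative_diff has_vector_derivative_mult_right d1 x)
      moreover have "\<mu> * (of_real x * y1 x - \<mu> * y2 x) - (of_real x * (\<mu> * y1 x - of_real x * y2 x) + of_real 1 * y2 x)
          = (of_real (x\<^sup>2 - 1) - \<mu>\<^sup>2) * y2 x"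
        by (simp add: algebra_simps power2_eq_square)
      ultimately show "((\<lambda>x. \<mu> * y1 x - of_real x * y2 x) has_vector_derivative
          (of_real (x\<^sup>2 - 1) - \<mu>\<^sup>2) * y2 x) (at x within {0..})" by simp
    qed (use energy boundary in auto)
    then consider "\<forall>x\<ge>0. y2 x = 0"
      | n c where "\<mu>\<^sup>2 = of_nat (2 * n)" "\<forall>x\<ge>0. y2 x = c * of_real (hermite_fun n x)"
      using oscillator_eigenfunctions by blast
    then show ?thesis
    proof cases
      case 1
      have "y1 x = 0" if "x \<ge> 0" for x
      proof -
        have "\<mu> * y1 x - of_real x * y2 x = 0"
        proof (rule vector_derivative_unique_within[OF at_within_half_line_neq_bot[OF that] d2[OF that]])
          have "((\<lambda>_. 0) has_vector_derivative 0) (at x within {0..})" by simp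
          then show "(y2 has_vector_derivative 0) (at x within {0..})"
            by (rule has_vector_derivative_transform[rotated 2]) (use 1 that in auto)
        qed
        then show ?thesis using 1 that False by simp
      qed
      then show ?thesis using 1 nontrivial by auto
    next
      case (2 n c)
      then obtain m where m: "n = Suc m" using False by (cases n) auto
      define s where "s = sqrt (2 * real (Suc m))"
      have s: "complex_of_real s \<noteq> 0" by (simp add: s_def)
      have "(complex_of_real s)\<^sup>2 = of_real (s\<^sup>2)" by (rule of_real_power[symmetric])
      also have "s\<^sup>2 = real (2 * n)" by (simp add: s_def m)
      finally have "\<mu>\<^sup>2 = (complex_of_real s)\<^sup>2" using 2(1) by simp
      \<comment> \<open>The square fixes \<mu> up to sign, and the sign decides between U_n and
        U_{-n}.\<close>
      then have mu: "\<mu> = of_real s \<or> \<mu> = - of_real s" by (simp only: power2_eq_iff)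
      have y1: "\<mu> * y1 x = c * of_real s * of_real (hermite_fun m x)" if "x \<ge> 0" for x
      proof -
        have "\<mu> * y1 x - of_real x * y2 x = c * of_real (s * hermite_fun m x - x * hermite_fun n x)"
        proof (rule vector_derivative_unique_within[OF at_within_half_line_neq_bot[OF that] d2[OF that]])
          have "((\<lambda>x. c * of_real (hermite_fun n x)) has_vector_derivative
              c * of_real (s * hermite_fun m x - x * hermite_fun n x)) (at x within {0..})"
            unfolding s_def m
            by (intro has_vector_derivative_mult_right has_vector_derivative_complex_of_real hermite_fun_lower)
          then show "(y2 has_vector_derivative c * of_real (s * hermite_fun m x - x * hermite_fun n x)) (at x within {0..})"
            by (rule has_vector_derivative_transform[rotated 2]) (use 2 that in auto)
        qed
        then show ?thesis using 2(2) that by (simp add: algebra_simps)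
      qed
      show ?thesis
        using mu
      proof
        assume mu: "\<mu> = of_real s"
        then have "y1 x = c * U (int (Suc m)) x $ 1 \<and> y2 x = c * U (int (Suc m)) x $ 2" if "x \<ge> 0" for x
          using y1[OF that] 2(2) that s m by (simp add: U_pos del: of_nat_Suc)
        moreover have "\<mu> = of_real (dirac_eig (int (Suc m)))" unfolding dirac_eig_pos mu s_def ..
        ultimately show ?thesis by blast
      next
        assume mu: "\<mu> = - of_real s"
        have "y1 x = c * U (- int (Suc m)) x $ 1 \<and> y2 x = c * U (- int (Suc m)) x $ 2" if "x \<ge> 0" for x
        proof -
          have "of_real s * (- y1 x) = of_real s * (c * of_real (hermite_fun m x))"
            using y1[OF that] mu by (simp add: mult_ac)
          then have "- y1 x = c * of_real (hermite_fun m x)" using mult_left_cancel[OF s] by blast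
          then have "y1 x = - (c * of_real (hermite_fun m x))" by (simp add: minus_equation_iff[of "y1 x"])
          then show ?thesis using 2(2) that m by (simp add: U_neg del: of_nat_Suc)
        qed
        moreover have "\<mu> = of_real (dirac_eig (- int (Suc m)))" unfolding dirac_eig_neg mu s_def by simp
        ultimately show ?thesis by blast
      qed
    qed
  qed
  then show ?thesis using nontrivial by (metis mult_zero_left)
qed

section \<open>From almost everywhere equations to classical solutions\<close>

lemma absolutely_continuous_derivative_half_line:
  fixes f g :: "real \<Rightarrow> complex"
  assumes ac: "\<And>b. b > 0 \<Longrightarrow> absolutely_continuous_on_interval 0 b f"
    and N: "negligible N" and der: "\<And>x. \<lbrakk>x > 0; x \<notin> N\<rbrakk> \<Longrightarrow> (f has_vector_derivative g x) (at x)"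
    and cont: "continuous_on {0..} g" and "x \<ge> 0"
  shows "(f has_vector_derivative g x) (at x within {0..})"
proof -
  have f: "f 0 + integral {0..t} g = f t" if "t \<ge> 0" for t
  proof (cases "t = 0")
    case False
    have "(g has_integral f t - f 0) {0..t}"
    proof (rule absolutely_continuous_has_integral_derivative)
      \<comment> \<open>The endpoint joins the exceptional set, since derivatives are given at
        positive arguments only.\<close>
      show "negligible (insert 0 N)" using N by simp
      show "(f has_vector_derivative g z) (at z within {0..t})" if "z \<in> {0..t} - insert 0 N" for z
        by (rule has_vector_derivative_at_within[OF der]) (use that in auto)
    qed (use that False ac in auto)
    then show ?thesis by (simp add: integral_unique)
  qed simp
  have "((\<lambda>t. integral {0..t} g) has_vector_derivative g x) (at x within {0..x + 1})"
    using \<open>x \<ge> 0\<close> by (intro integral_has_vector_derivative continuous_on_subset[OF cont]) auto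
  then have "((\<lambda>t. f 0 + integral {0..t} g) has_vector_derivative 0 + g x) (at x within {0..x + 1})"
    by (intro has_vector_derivative_add has_vector_derivative_const)
  then have "((\<lambda>t. f 0 + integral {0..t} g) has_vector_derivative g x) (at x within {0..x + 1})" by simp
  then have "(f has_vector_derivative g x) (at x within {0..x + 1})"
    by (rule has_vector_derivative_transform[rotated 2]) (use f \<open>x \<ge> 0\<close> in auto)
  \<comment> \<open>Near \<open>x\<close> the interval and the half line agree, because the right
    end \<open>x + 1\<close> stays away from \<open>x\<close>.\<close>
  moreover have "at x within {0..x + 1} = at x within {0..}"
    by (rule at_within_nhd[of _ "{..<x + 1}"]) auto
  ultimately show ?thesis by simp
qed

lemma absolutely_continuous_imp_continuous_half_line:
  fixes f :: "real \<Rightarrow> complex"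
  assumes ac: "\<And>b. b > 0 \<Longrightarrow> absolutely_continuous_on_interval 0 b f"
  shows "continuous_on {0..} f"
  unfolding continuous_on_eq_continuous_within
proof
  fix x :: real assume x: "x \<in> {0..}"
  then have "continuous_on {0..x + 1} f"
    by (intro absolutely_continuous_imp_continuous_on ac) auto
  then have "continuous (at x within {0..x + 1}) f"
    using x by (auto simp: continuous_on_eq_continuous_within)
  moreover have "at x within {0..x + 1} = at x within {0..}"
    by (rule at_within_nhd[of _ "{..<x + 1}"]) auto
  ultimately show "continuous (at x within {0..}) f" by simp
qed

lemma square_integrable_finite_energy:
  assumes "square_integrable_half_axis f" and cont: "continuous_on {0..} f"
  shows "finite_energy f"
proof -
  let ?g = "\<lambda>x. (cmod (f x))\<^sup>2"
  have "?g absolutely_integrable_on {0<..}"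
    using assms(1) by (simp add: square_integrable_half_axis_def integrable_restrict_space set_integrable_def)
  then have "?g integrable_on {0<..}" by (rule set_lebesgue_integral_eq_integral(1))
  then have int: "?g integrable_on {0..}"
    by (rule integrable_spike_set) (rule negligible_subset[OF negligible_sing[of 0]], force)+
  have contg: "continuous_on {0..} ?g" by (intro continuous_intros cont)
  have "((\<lambda>t. integral {0..t} ?g) has_real_derivative ?g x) (at x within {0..}) \<and>
      integral {0..x} ?g \<le> integral {0..} ?g" if x: "x \<ge> 0" for x
  proof
    have "((\<lambda>t. integral {0..t} ?g) has_real_derivative ?g x) (at x within {0..x + 1})"
      using x by (intro integral_has_real_derivative continuous_on_subset[OF contg]) auto
    moreover have "at x within {0..x + 1} = at x within {0..}"
      by (rule at_within_nhd[of _ "{..<x + 1}"]) auto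
    ultimately show "((\<lambda>t. integral {0..t} ?g) has_real_derivative ?g x) (at x within {0..})" by simp
    show "integral {0..x} ?g \<le> integral {0..} ?g"
      by (intro integral_subset_le int integrable_continuous_interval continuous_on_subset[OF contg]) auto
  qed
  then show ?thesis unfolding finite_energy_def by blast
qed

section \<open>Matrix form and scalar form of the system\<close>

lemma matrix_expr_components:
  fixes w v :: "complex^2"
  shows "B *v w + Omega0 x *v v = \<mu> *s v \<longleftrightarrow>
    w $ 1 = of_real x * v $ 1 - \<mu> * v $ 2 \<and> w $ 2 = \<mu> * v $ 1 - of_real x * v $ 2"
proof -
  have "(B *v w + Omega0 x *v v) $ 1 = w $ 2 + of_real x * v $ 2"
    "(B *v w + Omega0 x *v v) $ 2 = - w $ 1 + of_real x * v $ 1"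
    by (simp_all add: B_def Omega0_def matrix_vector_mult_def sum_2)
  moreover have "a + b = c \<longleftrightarrow> a = c - b" "- a + b = c \<longleftrightarrow> a = b - c" for a b c :: complex
    by (auto simp: algebra_simps)
  ultimately show ?thesis unfolding vec_eq_iff forall_2 by auto
qed

lemma has_vector_derivative_vec_2:
  fixes y :: "real \<Rightarrow> complex^2"
  assumes "((\<lambda>x. y x $ 1) has_vector_derivative w $ 1) F" "((\<lambda>x. y x $ 2) has_vector_derivative w $ 2) F"
  shows "(y has_vector_derivative w) F"
proof -
  have split: "v = axis 1 (v $ 1) + axis 2 (v $ 2)" for v :: "complex^2"
    by (simp add: vec_eq_iff forall_2 axis_def)
  have bl: "bounded_linear (axis k :: complex \<Rightarrow> complex^2)" for k :: 2
    unfolding linear_conv_bounded_linear[symmetric]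
    by (rule linearI) (auto simp: vec_eq_iff axis_def)
  have "((\<lambda>x. axis 1 (y x $ 1) + axis 2 (y x $ 2) :: complex^2) has_vector_derivative axis 1 (w $ 1) + axis 2 (w $ 2)) F"
    by (intro has_vector_derivative_add bounded_linear.has_vector_derivative[OF bl] assms)
  then show ?thesis by (simp only: split[symmetric])
qed

lemma dirac_expr_iff:
  "dirac_expr y x (\<mu> *s y x) \<longleftrightarrow>
    ((\<lambda>x. y x $ 1) has_vector_derivative of_real x * y x $ 1 - \<mu> * y x $ 2) (at x) \<and>
    ((\<lambda>x. y x $ 2) has_vector_derivative \<mu> * y x $ 1 - of_real x * y x $ 2) (at x)"
proof
  assume "dirac_expr y x (\<mu> *s y x)"
  then obtain w where w: "(y has_vector_derivative w) (at x)" "\<mu> *s y x = B *v w + Omega0 x *v y x"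
    unfolding dirac_expr_def by blast
  have "((\<lambda>x. y x $ k) has_vector_derivative w $ k) (at x)" for k
    by (rule bounded_linear.has_vector_derivative[OF bounded_linear_vec_nth w(1)])
  then show "((\<lambda>x. y x $ 1) has_vector_derivative of_real x * y x $ 1 - \<mu> * y x $ 2) (at x) \<and>
    ((\<lambda>x. y x $ 2) has_vector_derivative \<mu> * y x $ 1 - of_real x * y x $ 2) (at x)"
    using w(2)[symmetric] unfolding matrix_expr_components by metis
next
  assume *: "((\<lambda>x. y x $ 1) has_vector_derivative of_real x * y x $ 1 - \<mu> * y x $ 2) (at x) \<and>
    ((\<lambda>x. y x $ 2) has_vector_derivative \<mu> * y x $ 1 - of_real x * y x $ 2) (at x)"
  define w :: "complex^2" where "w = vector [of_real x * y x $ 1 - \<mu> * y x $ 2, \<mu> * y x $ 1 - of_real x * y x $ 2]"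
  have w: "w $ 1 = of_real x * y x $ 1 - \<mu> * y x $ 2" "w $ 2 = \<mu> * y x $ 1 - of_real x * y x $ 2"
    by (simp_all add: w_def)
  have "(y has_vector_derivative w) (at x)"
    by (rule has_vector_derivative_vec_2) (simp_all only: w *)
  moreover have "B *v w + Omega0 x *v y x = \<mu> *s y x"
    unfolding matrix_expr_components using w by simp
  ultimately show "dirac_expr y x (\<mu> *s y x)" unfolding dirac_expr_def by metis
qed

text \<open>Reducing the boundary condition to the vanishing of component \<open>k\<close> lets the
  angles 0 and pi/2 share one proof, with \<open>k = 1\<close> and \<open>k = 2\<close>.\<close>

theorem dirac_eigenfunction_iff:
  assumes bc: "\<And>z::complex^2. z $ 1 * of_real (cos \<alpha>) + z $ 2 * of_real (sin \<alpha>) = 0 \<longleftrightarrow> z $ k = 0"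
  shows "dirac_eigenfunction \<alpha> \<mu> y \<longleftrightarrow>
    (\<exists>n c. \<mu> = of_real (dirac_eig n) \<and> U n 0 $ k = 0 \<and> c \<noteq> 0 \<and> (\<forall>x\<ge>0. y x = c *s U n x))"
proof
  assume y: "dirac_eigenfunction \<alpha> \<mu> y"
  have L2: "square_integrable_half_axis (\<lambda>x. y x $ j)" for j
    using y by (auto simp: dirac_eigenfunction_def dirac_domain_def)
  have ac: "absolutely_continuous_on_interval 0 b (\<lambda>x. y x $ j)" if "b > 0" for b j
    using y that by (auto simp: dirac_eigenfunction_def dirac_domain_def)
  have cont: "continuous_on {0..} (\<lambda>x. y x $ j)" for j
    by (intro absolutely_continuous_imp_continuous_half_line ac)
  have "AE x in lebesgue. x \<in> {0<..} \<longrightarrow> dirac_expr y x (\<mu> *s y x)"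
    using y by (simp add: dirac_eigenfunction_def AE_restrict_space_iff)
  then obtain N where N: "negligible N" "\<And>x. \<lbrakk>x > 0; x \<notin> N\<rbrakk> \<Longrightarrow> dirac_expr y x (\<mu> *s y x)"
    unfolding eventually_ae_filter_negligible by auto
  note der = N(2)[unfolded dirac_expr_iff]
  have y0: "y 0 $ k = 0" using y bc by (auto simp: dirac_eigenfunction_def dirac_domain_def)
  have "\<exists>n c. \<mu> = of_real (dirac_eig n) \<and> c \<noteq> 0 \<and>
      (\<forall>x\<ge>0. y x $ 1 = c * U n x $ 1 \<and> y x $ 2 = c * U n x $ 2)"
  proof (rule dirac_system_solutions)
    fix x :: real assume x: "x \<ge> 0"
    show "((\<lambda>x. y x $ 1) has_vector_derivative of_real x * y x $ 1 - \<mu> * y x $ 2) (at x within {0..})"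
      by (rule absolutely_continuous_derivative_half_line[OF ac N(1) conjunct1[OF der] _ x])
        (assumption | intro continuous_intros cont)+
    show "((\<lambda>x. y x $ 2) has_vector_derivative \<mu> * y x $ 1 - of_real x * y x $ 2) (at x within {0..})"
      by (rule absolutely_continuous_derivative_half_line[OF ac N(1) conjunct2[OF der] _ x])
        (assumption | intro continuous_intros cont)+
  next
    show "finite_energy (\<lambda>x. y x $ 1)" "finite_energy (\<lambda>x. y x $ 2)"
      by (intro square_integrable_finite_energy L2 cont)+
    show "y 0 $ 1 = 0 \<or> y 0 $ 2 = 0" using y0 exhaust_2[of k] by auto
    show "\<exists>x\<ge>0. y x $ 1 \<noteq> 0 \<or> y x $ 2 \<noteq> 0"
      using y by (auto simp: dirac_eigenfunction_def vec_eq_iff forall_2)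
  qed
  then obtain n c where nc: "\<mu> = of_real (dirac_eig n)" "c \<noteq> 0" "\<And>x. x \<ge> 0 \<Longrightarrow> y x = c *s U n x"
    by (auto simp: vec_eq_iff forall_2)
  then have "U n 0 $ k = 0" using y0 by auto
  with nc show "\<exists>n c. \<mu> = of_real (dirac_eig n) \<and> U n 0 $ k = 0 \<and> c \<noteq> 0 \<and> (\<forall>x\<ge>0. y x = c *s U n x)"
    by blast
next
  assume "\<exists>n c. \<mu> = of_real (dirac_eig n) \<and> U n 0 $ k = 0 \<and> c \<noteq> 0 \<and> (\<forall>x\<ge>0. y x = c *s U n x)"
  then obtain n c where mu: "\<mu> = of_real (dirac_eig n)" and k: "U n 0 $ k = 0" and c: "c \<noteq> 0"
    and y: "\<And>x. x \<ge> 0 \<Longrightarrow> y x = c *s U n x" by blast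
  have der: "((\<lambda>x. y x $ 1) has_vector_derivative of_real x * y x $ 1 - \<mu> * y x $ 2) (at x within {0..})"
    "((\<lambda>x. y x $ 2) has_vector_derivative \<mu> * y x $ 1 - of_real x * y x $ 2) (at x within {0..})"
    if x: "x \<ge> 0" for x
  proof -
    have "((\<lambda>x. c * U n x $ 1) has_vector_derivative c * (of_real x * U n x $ 1 - \<mu> * U n x $ 2)) (at x within {0..})"
      unfolding mu by (intro has_vector_derivative_mult_right U_deriv)
    then have "((\<lambda>x. y x $ 1) has_vector_derivative c * (of_real x * U n x $ 1 - \<mu> * U n x $ 2)) (at x within {0..})"
      by (rule has_vector_derivative_transform[rotated 2]) (use y x in auto)
    then show "((\<lambda>x. y x $ 1) has_vector_derivative of_real x * y x $ 1 - \<mu> * y x $ 2) (at x within {0..})"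
      using y[OF x] by (simp add: algebra_simps)
    have "((\<lambda>x. c * U n x $ 2) has_vector_derivative c * (\<mu> * U n x $ 1 - of_real x * U n x $ 2)) (at x within {0..})"
      unfolding mu by (intro has_vector_derivative_mult_right U_deriv)
    then have "((\<lambda>x. y x $ 2) has_vector_derivative c * (\<mu> * U n x $ 1 - of_real x * U n x $ 2)) (at x within {0..})"
      by (rule has_vector_derivative_transform[rotated 2]) (use y x in auto)
    then show "((\<lambda>x. y x $ 2) has_vector_derivative \<mu> * y x $ 1 - of_real x * y x $ 2) (at x within {0..})"
      using y[OF x] by (simp add: algebra_simps)
  qed
  have cont: "continuous_on {0..} (\<lambda>x. y x $ j)" for j
    by (rule continuous_on_eq[of _ "\<lambda>x. c * U n x $ j"])
      (auto intro!: continuous_intros continuous_on_U simp: y)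
  have "dirac_expr y x (\<mu> *s y x)" if "x > 0" for x
  proof -
    \<comment> \<open>\<open>dirac_expr\<close> asks for a two-sided derivative, which at interior
      points coincides with the one within the half line.\<close>
    have "at x within {0..} = at x" using that by (intro at_within_interior) auto
    then show ?thesis using der[of x] that by (simp add: dirac_expr_iff)
  qed
  then have expr: "AE x in lebesgue_on {0<..}. dirac_expr y x (\<mu> *s y x)"
    by (intro AE_I2) simp
  have ac: "absolutely_continuous_on_interval 0 b (\<lambda>x. y x $ j)" for b j
  proof -
    have "absolutely_continuous_on_interval 0 b (\<lambda>x. y x $ 1)"
      by (rule continuous_derivative_absolutely_continuous[OF has_vector_derivative_within_subset[OF der(1)]])
        (auto intro!: continuous_intros continuous_on_subset[OF cont])
    moreover have "absolutely_continuous_on_interval 0 b (\<lambda>x. y x $ 2)"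
      by (rule continuous_derivative_absolutely_continuous[OF has_vector_derivative_within_subset[OF der(2)]])
        (auto intro!: continuous_intros continuous_on_subset[OF cont])
    ultimately show ?thesis using exhaust_2[of j] by auto
  qed
  have L2: "square_integrable_half_axis (\<lambda>x. y x $ j)" for j
    by (rule square_integrable_U[of _ c n j]) (simp add: y)
  have L2': "square_integrable_half_axis (\<lambda>x. (\<mu> *s y x) $ j)" for j
    by (rule square_integrable_U[of _ "\<mu> * c" n j]) (simp add: y)
  have "y 0 $ k = 0" using y[of 0] k by simp
  then have "y \<in> dirac_domain \<alpha>"
    unfolding dirac_domain_def bc
    by (intro CollectI conjI allI impI exI[of _ "\<lambda>x. \<mu> *s y x"] L2 L2' ac expr)
  \<comment> \<open>Exactly one component of U_n vanishes at 0, so the other witnesses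
    nontriviality.\<close>
  moreover have "y 0 \<noteq> 0" using y[of 0] c U_at_0[of n] by (auto simp: vec_eq_iff forall_2)
  ultimately show "dirac_eigenfunction \<alpha> \<mu> y" unfolding dirac_eigenfunction_def using expr by blast
qed

section \<open>Spectra for the two boundary conditions\<close>

lemma eigenvalue_0_eq: "eigenvalue_0 k = dirac_eig (2 * k)"
proof -
  have "sqrt (2 * of_int \<bar>2 * k\<bar>) = sqrt (2\<^sup>2 * real_of_int \<bar>k\<bar>)" by (simp add: abs_mult)
  also have "\<dots> = 2 * sqrt (of_int \<bar>k\<bar>)" by (simp only: real_sqrt_mult) simp
  finally show ?thesis by (simp only: eigenvalue_0_def dirac_eig_def) (simp add: sgn_mult)
qed

lemma eigenvalue_pi_half_eq: "eigenvalue_pi_half k = dirac_eig (2 * k + 1)"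
  by (simp add: eigenvalue_pi_half_def dirac_eig_def)

lemma spectrum_description:
  fixes e :: "int \<Rightarrow> real" and h :: "int \<Rightarrow> int"
  assumes eig: "\<And>\<mu> y. dirac_eigenfunction \<alpha> \<mu> y \<longleftrightarrow>
      (\<exists>n c. \<mu> = of_real (dirac_eig n) \<and> n \<in> range h \<and> c \<noteq> 0 \<and> (\<forall>x\<ge>0. y x = c *s U n x))"
    and e: "\<And>k. e k = dirac_eig (h k)"
  shows "{\<mu>. dirac_eigenvalue \<alpha> \<mu>} = range (\<lambda>k. complex_of_real (e k))"
    and "dirac_eigenfunction \<alpha> (complex_of_real (e k)) y \<longleftrightarrow>
      (\<exists>c. c \<noteq> 0 \<and> (\<forall>x\<ge>0. y x = c *s U (h k) x))"
proof -
  have "dirac_eigenvalue \<alpha> \<mu> \<longleftrightarrow> (\<exists>n \<in> range h. \<mu> = of_real (dirac_eig n))" for \<mu>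
  proof
    assume "\<exists>n \<in> range h. \<mu> = of_real (dirac_eig n)"
    then obtain n where "n \<in> range h" "\<mu> = of_real (dirac_eig n)" by blast
    then have "dirac_eigenfunction \<alpha> \<mu> (\<lambda>x. 1 *s U n x)" unfolding eig by (intro exI[of _ n] exI[of _ 1]) auto
    then show "dirac_eigenvalue \<alpha> \<mu>" unfolding dirac_eigenvalue_def by blast
  qed (auto simp: dirac_eigenvalue_def eig)
  then show "{\<mu>. dirac_eigenvalue \<alpha> \<mu>} = range (\<lambda>k. complex_of_real (e k))"
    by (auto simp: e)
  show "dirac_eigenfunction \<alpha> (complex_of_real (e k)) y \<longleftrightarrow>
      (\<exists>c. c \<noteq> 0 \<and> (\<forall>x\<ge>0. y x = c *s U (h k) x))"
    unfolding eig e of_real_eq_iff inj_eq[OF inj_dirac_eig] by blast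
qed

theorem mainTheorem2:
  shows "{\<mu>. dirac_eigenvalue 0 \<mu>} = range (\<lambda>k::int. complex_of_real (eigenvalue_0 k)) \<and>
    (\<forall>(k::int) y. dirac_eigenfunction 0 (complex_of_real (eigenvalue_0 k)) y \<longleftrightarrow>
       (\<exists>c::complex. c \<noteq> 0 \<and> (\<forall>x\<ge>0. y x = c *s U (2 * k) x))) \<and>
    {\<mu>. dirac_eigenvalue (pi / 2) \<mu>} =
      range (\<lambda>k::int. complex_of_real (eigenvalue_pi_half k)) \<and>
    (\<forall>(k::int) y. dirac_eigenfunction (pi / 2) (complex_of_real (eigenvalue_pi_half k)) y \<longleftrightarrow>
       (\<exists>c::complex. c \<noteq> 0 \<and> (\<forall>x\<ge>0. y x = c *s U (2 * k + 1) x)))"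
proof -
  have even: "U n 0 $ 1 = 0 \<longleftrightarrow> n \<in> range (\<lambda>k. 2 * k)" for n
    unfolding U_at_0 by auto
  have odd: "U n 0 $ 2 = 0 \<longleftrightarrow> n \<in> range (\<lambda>k. 2 * k + 1)" for n
    unfolding U_at_0 by (auto elim: oddE)
  have "dirac_eigenfunction 0 \<mu> y \<longleftrightarrow>
      (\<exists>n c. \<mu> = of_real (dirac_eig n) \<and> n \<in> range (\<lambda>k. 2 * k) \<and> c \<noteq> 0 \<and> (\<forall>x\<ge>0. y x = c *s U n x))" for \<mu> y
    unfolding even[symmetric] by (rule dirac_eigenfunction_iff) simp
  note dirichlet = spectrum_description[OF this eigenvalue_0_eq]
  have "dirac_eigenfunction (pi / 2) \<mu> y \<longleftrightarrow>
      (\<exists>n c. \<mu> = of_real (dirac_eig n) \<and> n \<in> range (\<lambda>k. 2 * k + 1) \<and> c \<noteq> 0 \<and> (\<forall>x\<ge>0. y x = c *s U n x))" for \<mu> y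
    unfolding odd[symmetric] by (rule dirac_eigenfunction_iff) simp
  note neumann = spectrum_description[OF this eigenvalue_pi_half_eq]
  show ?thesis using dirichlet neumann by blast
qed

end
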